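(* Let $Q$ be the quiver with two vertices $1,2$, a loop $\alpha$ at $1$, an arrow $\beta:1\to2$ and a loop $\gamma$ at $2$, and let $\Gamma=\mathbb{K}Q/I$, where $I$ is the ideal generated by $\beta\alpha-\gamma\beta$, $\alpha^2$ and $\gamma^2$. Then $\Gamma$ is not a 2-Calabi--Yau-tilted algebra.
   Context: $\mathbb{K}$ is an algebraically closed field of characteristic zero. A Hom-finite, Krull--Schmidt, $\mathbb{K}$-linear triangulated category $\mathcal{C}$ with shift $\Sigma$ is 2-Calabi--Yau if there is a natural isomorphism $D\mathrm{Hom}(X,Y)\simeq\mathrm{Hom}(Y,\Sigma^2X)$, where $D=\mathrm{Hom}_{\mathbb{K}}(-,\mathbb{K})$. An object $T$ of $\mathcal{C}$ is cluster tilting if $\mathrm{Hom}(T,\Sigma T)=0$ and $\mathrm{Hom}(T,\Sigma X)=0$ implies $X\in\mathrm{add}\,T$. A finite-dimensional $\mathbb{K}$-algebra is 2-Calabi--Yau-tilted if it is isomorphic to the endomorphism algebra of a cluster tilting object in some such 2-Calabi--Yau triangulated category. *)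

theory Defs
  imports
    "HOL-Algebra.Algebraic_Closure"
    "Graph_Theory.Arc_Walk"
    "Jordan_Normal_Form.Missing_VectorSpace"
begin

section \<open>Algebras over a field\<close>

definition char_zero :: "('k, 'r) ring_scheme \<Rightarrow> bool" where
  "char_zero K \<longleftrightarrow> (\<forall>n::nat. 0 < n \<longrightarrow> [n] \<cdot>\<^bsub>K\<^esub> \<one>\<^bsub>K\<^esub> \<noteq> \<zero>\<^bsub>K\<^esub>)"

text \<open>
  The library locale \<open>algebra\<close> is restricted to commutative algebras.  An algebra is a
  \<open>module\<close> record whose \<open>mult\<close> and \<open>one\<close> fields are meaningful.
\<close>

definition algebra_iso ::
  "('k, 'r) ring_scheme \<Rightarrow> ('k, 'a, 'y) module_scheme \<Rightarrow> ('k, 'b, 'z) module_scheme \<Rightarrow> ('a \<Rightarrow> 'b) set"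
  where "algebra_iso K A B =
    {h \<in> ring_iso A B. \<forall>c \<in> carrier K. \<forall>x \<in> carrier A. h (c \<odot>\<^bsub>A\<^esub> x) = c \<odot>\<^bsub>B\<^esub> h x}"

definition quotient_algebra ::
  "('k, 'a, 'z) module_scheme \<Rightarrow> 'a set \<Rightarrow> ('k, 'a set) module"
  where "quotient_algebra A I =
    \<lparr>carrier = carrier (A Quot I), monoid.mult = monoid.mult (A Quot I), one = one (A Quot I),
     zero = zero (A Quot I), add = add (A Quot I),
     smult = (\<lambda>c S. \<Union>x\<in>S. I +>\<^bsub>A\<^esub> (c \<odot>\<^bsub>A\<^esub> x))\<rparr>"

text \<open>Not necessarily commutative local rings.\<close>

definition local_ring :: "('a, 'z) ring_scheme \<Rightarrow> bool" where
  "local_ring R \<longleftrightarrow> ring R \<and> \<one>\<^bsub>R\<^esub> \<noteq> \<zero>\<^bsub>R\<^esub> \<and>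
    (\<forall>a \<in> carrier R - Units R. \<forall>b \<in> carrier R - Units R. a \<oplus>\<^bsub>R\<^esub> b \<notin> Units R)"

definition self_module :: "('k, 'r) ring_scheme \<Rightarrow> ('k, 'k) module" where
  "self_module K = \<lparr>carrier = carrier K, monoid.mult = monoid.mult K, one = one K,
    zero = zero K, add = add K, smult = monoid.mult K\<rparr>"

text \<open>
  Linear forms are made extensional, so that equality in the dual space is equality on \<open>carrier V\<close>.
\<close>

definition dual_space ::
  "('k, 'r) ring_scheme \<Rightarrow> ('k, 'm, 'z) module_scheme \<Rightarrow> ('k, 'm \<Rightarrow> 'k) module"
  where "dual_space K V = (ring.func_space K (carrier V))
    \<lparr>carrier := module_hom K V (self_module K) \<inter> extensional (carrier V)\<rparr>"


section \<open>Path algebras of quivers\<close>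

text \<open>
  A quiver is a \<open>pre_digraph\<close> (loops and multiple arcs are allowed).  A path is encoded by its
  start vertex together with its list of arcs in the order in which they are traversed.
\<close>

definition qpaths :: "('v, 'e) pre_digraph \<Rightarrow> ('v \<times> 'e list) set" where
  "qpaths G = {(u, p). \<exists>v. pre_digraph.awalk G u p v}"

definition qsource :: "'v \<times> 'e list \<Rightarrow> 'v" where
  "qsource x = fst x"

definition qtarget :: "('v, 'e) pre_digraph \<Rightarrow> 'v \<times> 'e list \<Rightarrow> 'v" where
  "qtarget G x = pre_digraph.awlast G (fst x) (snd x)"

text \<open>
  Paths compose from right to left, like functions: in \<open>qcomp y x\<close> the path \<open>x\<close> is traversed first.
  This is the convention under which \<open>\<beta>\<alpha>\<close> is a path for \<open>\<alpha>\<close> a loop at the source of \<open>\<beta>\<close>.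
\<close>

definition qcomp :: "'v \<times> 'e list \<Rightarrow> 'v \<times> 'e list \<Rightarrow> 'v \<times> 'e list" where
  "qcomp y x = (fst x, snd x @ snd y)"

definition qsplits ::
  "('v, 'e) pre_digraph \<Rightarrow> 'v \<times> 'e list \<Rightarrow> (('v \<times> 'e list) \<times> ('v \<times> 'e list)) set"
  where "qsplits G z =
    {(y, x). y \<in> qpaths G \<and> x \<in> qpaths G \<and> qsource y = qtarget G x \<and> qcomp y x = z}"

definition path_algebra ::
  "('k, 'r) ring_scheme \<Rightarrow> ('v, 'e) pre_digraph \<Rightarrow> ('k, 'v \<times> 'e list \<Rightarrow> 'k) module"
  where "path_algebra K G =
    \<lparr>carrier = {f. range f \<subseteq> carrier K \<and> {z. f z \<noteq> \<zero>\<^bsub>K\<^esub>} \<subseteq> qpaths G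
                   \<and> finite {z. f z \<noteq> \<zero>\<^bsub>K\<^esub>}},
     monoid.mult = (\<lambda>f g z. \<Oplus>\<^bsub>K\<^esub>s \<in> qsplits G z. f (fst s) \<otimes>\<^bsub>K\<^esub> g (snd s)),
     one = (\<lambda>z. if z \<in> qpaths G \<and> snd z = [] then \<one>\<^bsub>K\<^esub> else \<zero>\<^bsub>K\<^esub>),
     zero = (\<lambda>z. \<zero>\<^bsub>K\<^esub>),
     add = (\<lambda>f g z. f z \<oplus>\<^bsub>K\<^esub> g z),
     smult = (\<lambda>c f z. c \<otimes>\<^bsub>K\<^esub> f z)\<rparr>"

definition path_elt :: "('k, 'r) ring_scheme \<Rightarrow> 'v \<times> 'e list \<Rightarrow> 'v \<times> 'e list \<Rightarrow> 'k" where
  "path_elt K z = (\<lambda>z'. if z' = z then \<one>\<^bsub>K\<^esub> else \<zero>\<^bsub>K\<^esub>)"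

definition arrow_elt ::
  "('k, 'r) ring_scheme \<Rightarrow> ('v, 'e) pre_digraph \<Rightarrow> 'e \<Rightarrow> 'v \<times> 'e list \<Rightarrow> 'k" where
  "arrow_elt K G a = path_elt K (tail G a, [a])"


section \<open>The algebra \<open>\<Gamma>\<close>\<close>

datatype arrow = Alpha | Beta | Gamma

definition quiver_Q :: "(nat, arrow) pre_digraph" where
  "quiver_Q = \<lparr>verts = {1, 2}, arcs = {Alpha, Beta, Gamma},
     tail = (\<lambda>a. case a of Alpha \<Rightarrow> 1 | Beta \<Rightarrow> 1 | Gamma \<Rightarrow> 2),
     head = (\<lambda>a. case a of Alpha \<Rightarrow> 1 | Beta \<Rightarrow> 2 | Gamma \<Rightarrow> 2)\<rparr>"

definition ideal_I :: "('k, 'r) ring_scheme \<Rightarrow> (nat \<times> arrow list \<Rightarrow> 'k) set" where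
  "ideal_I K =
    (let KQ = path_algebra K quiver_Q;
         \<alpha> = arrow_elt K quiver_Q Alpha;
         \<beta> = arrow_elt K quiver_Q Beta;
         \<gamma> = arrow_elt K quiver_Q Gamma
     in Idl\<^bsub>KQ\<^esub> {(\<beta> \<otimes>\<^bsub>KQ\<^esub> \<alpha>) \<ominus>\<^bsub>KQ\<^esub> (\<gamma> \<otimes>\<^bsub>KQ\<^esub> \<beta>), \<alpha> \<otimes>\<^bsub>KQ\<^esub> \<alpha>, \<gamma> \<otimes>\<^bsub>KQ\<^esub> \<gamma>})"

definition algebra_Gamma :: "('k, 'r) ring_scheme \<Rightarrow> ('k, (nat \<times> arrow list \<Rightarrow> 'k) set) module" where
  "algebra_Gamma K = quotient_algebra (path_algebra K quiver_Q) (ideal_I K)"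


section \<open>Linear categories\<close>

text \<open>
  Objects are called \<open>L\<close>, \<open>M\<close>, \<open>N\<close>, since \<open>X\<close> is reserved by the polynomial syntax.  Only the additive group and scalar
  multiplication of the record \<open>Hom C L M\<close> are used.  The sets \<open>carrier (Hom C L M)\<close> are not
  required to be disjoint.
\<close>

record ('k, 'o, 'm) linear_cat =
  Ob :: "'o set"
  Hom :: "'o \<Rightarrow> 'o \<Rightarrow> ('k, 'm) module"
  Comp :: "'m \<Rightarrow> 'm \<Rightarrow> 'm"  (infixr \<open>\<star>\<index>\<close> 70)
  idm :: "'o \<Rightarrow> 'm"

abbreviation mor :: "('k, 'o, 'm, 'z) linear_cat_scheme \<Rightarrow> 'o \<Rightarrow> 'o \<Rightarrow> 'm set" where
  "mor C L M \<equiv> carrier (Hom C L M)"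

locale linear_category =
  fixes K :: "('k, 'r) ring_scheme" and C :: "('k, 'o, 'm, 'z) linear_cat_scheme" (structure)
  assumes Hom_vectorspace: "\<lbrakk>L \<in> Ob C; M \<in> Ob C\<rbrakk> \<Longrightarrow> vectorspace K (Hom C L M)"
    and comp_closed:
      "\<lbrakk>L \<in> Ob C; M \<in> Ob C; N \<in> Ob C; f \<in> mor C L M; g \<in> mor C M N\<rbrakk> \<Longrightarrow> g \<star> f \<in> mor C L N"
    and idm_closed: "L \<in> Ob C \<Longrightarrow> idm C L \<in> mor C L L"
    and comp_assoc:
      "\<lbrakk>J \<in> Ob C; L \<in> Ob C; M \<in> Ob C; N \<in> Ob C;
        f \<in> mor C J L; g \<in> mor C L M; h \<in> mor C M N\<rbrakk> \<Longrightarrow> (h \<star> g) \<star> f = h \<star> (g \<star> f)"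
    and comp_idm_left: "\<lbrakk>L \<in> Ob C; M \<in> Ob C; f \<in> mor C L M\<rbrakk> \<Longrightarrow> idm C M \<star> f = f"
    and comp_idm_right: "\<lbrakk>L \<in> Ob C; M \<in> Ob C; f \<in> mor C L M\<rbrakk> \<Longrightarrow> f \<star> idm C L = f"
    and comp_linear_right:
      "\<lbrakk>L \<in> Ob C; M \<in> Ob C; N \<in> Ob C; g \<in> mor C M N\<rbrakk>
        \<Longrightarrow> (\<lambda>f. g \<star> f) \<in> module_hom K (Hom C L M) (Hom C L N)"
    and comp_linear_left:
      "\<lbrakk>L \<in> Ob C; M \<in> Ob C; N \<in> Ob C; f \<in> mor C L M\<rbrakk>
        \<Longrightarrow> (\<lambda>g. g \<star> f) \<in> module_hom K (Hom C M N) (Hom C L N)"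

definition is_iso :: "('k, 'o, 'm, 'z) linear_cat_scheme \<Rightarrow> 'o \<Rightarrow> 'o \<Rightarrow> 'm \<Rightarrow> bool" where
  "is_iso C L M f \<longleftrightarrow> f \<in> mor C L M \<and>
    (\<exists>g \<in> mor C M L. g \<star>\<^bsub>C\<^esub> f = idm C L \<and> f \<star>\<^bsub>C\<^esub> g = idm C M)"

definition zero_object :: "('k, 'o, 'm, 'z) linear_cat_scheme \<Rightarrow> 'o \<Rightarrow> bool" where
  "zero_object C N \<longleftrightarrow> N \<in> Ob C \<and> idm C N = \<zero>\<^bsub>Hom C N N\<^esub>"

text \<open>\<open>S\<close> is a direct sum of the list \<open>Xs\<close> of objects; for the empty list, a zero object.\<close>

definition is_direct_sum :: "('k, 'o, 'm, 'z) linear_cat_scheme \<Rightarrow> 'o list \<Rightarrow> 'o \<Rightarrow> bool" where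
  "is_direct_sum C Xs S \<longleftrightarrow> set Xs \<subseteq> Ob C \<and> S \<in> Ob C \<and>
    (\<exists>\<iota> \<pi>.
      (\<forall>j < length Xs. \<iota> j \<in> mor C (Xs ! j) S \<and> \<pi> j \<in> mor C S (Xs ! j)) \<and>
      (\<forall>j < length Xs. \<forall>k < length Xs.
        \<pi> j \<star>\<^bsub>C\<^esub> \<iota> k = (if j = k then idm C (Xs ! j) else \<zero>\<^bsub>Hom C (Xs ! k) (Xs ! j)\<^esub>)) \<and>
      (\<Oplus>\<^bsub>Hom C S S\<^esub> j \<in> {..<length Xs}. \<iota> j \<star>\<^bsub>C\<^esub> \<pi> j) = idm C S)"

locale additive_linear_category = linear_category +
  assumes direct_sums_exist: "set Xs \<subseteq> Ob C \<Longrightarrow> \<exists>S. is_direct_sum C Xs S"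

definition in_add :: "('k, 'o, 'm, 'z) linear_cat_scheme \<Rightarrow> 'o \<Rightarrow> 'o \<Rightarrow> bool" where
  "in_add C T L \<longleftrightarrow>
    (\<exists>n S L'. is_direct_sum C (replicate n T) S \<and> is_direct_sum C [L, L'] S)"

definition End_algebra :: "('k, 'o, 'm, 'z) linear_cat_scheme \<Rightarrow> 'o \<Rightarrow> ('k, 'm) module" where
  "End_algebra C L = \<lparr>carrier = mor C L L, monoid.mult = Comp C, one = idm C L,
    zero = zero (Hom C L L), add = add (Hom C L L), smult = smult (Hom C L L)\<rparr>"

definition hom_finite ::
  "('k, 'r) ring_scheme \<Rightarrow> ('k, 'o, 'm, 'z) linear_cat_scheme \<Rightarrow> bool" where
  "hom_finite K C \<longleftrightarrow> (\<forall>L \<in> Ob C. \<forall>M \<in> Ob C. vectorspace.fin_dim K (Hom C L M))"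

definition krull_schmidt :: "('k, 'o, 'm, 'z) linear_cat_scheme \<Rightarrow> bool" where
  "krull_schmidt C \<longleftrightarrow>
    (\<forall>L \<in> Ob C. \<exists>Xs. is_direct_sum C Xs L \<and> (\<forall>M \<in> set Xs. local_ring (End_algebra C M)))"


section \<open>Triangulated categories\<close>

text \<open>
  \<open>Sh\<close> and \<open>ShM\<close> are the shift on objects and on morphisms.  The tuple \<open>(L, M, N, u, v, w)\<close> in
  \<open>Tri\<close> stands for the distinguished triangle \<open>L \<rightarrow> M \<rightarrow> N \<rightarrow> \<Sigma>L\<close> with maps \<open>u\<close>, \<open>v\<close>, \<open>w\<close>.
\<close>

record ('k, 'o, 'm) tri_cat = "('k, 'o, 'm) linear_cat" +
  Sh :: "'o \<Rightarrow> 'o"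
  ShM :: "'m \<Rightarrow> 'm"
  Tri :: "('o \<times> 'o \<times> 'o \<times> 'm \<times> 'm \<times> 'm) set"

definition is_triangle ::
  "('k, 'o, 'm, 'z) tri_cat_scheme \<Rightarrow> 'o \<times> 'o \<times> 'o \<times> 'm \<times> 'm \<times> 'm \<Rightarrow> bool" where
  "is_triangle C = (\<lambda>(L, M, N, u, v, w). L \<in> Ob C \<and> M \<in> Ob C \<and> N \<in> Ob C \<and>
     u \<in> mor C L M \<and> v \<in> mor C M N \<and> w \<in> mor C N (Sh C L))"

text \<open>
  The shift is only required to be an autoequivalence, which includes the case of an
  automorphism.  The axioms are Verdier's TR1 to TR4.
\<close>

locale triangulated_category =
  additive_linear_category K C
  for K :: "('k, 'r) ring_scheme" and C :: "('k, 'o, 'm, 'z) tri_cat_scheme" (structure) +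
  assumes Sh_closed: "L \<in> Ob C \<Longrightarrow> Sh C L \<in> Ob C"
    and ShM_idm: "L \<in> Ob C \<Longrightarrow> ShM C (idm C L) = idm C (Sh C L)"
    and ShM_comp:
      "\<lbrakk>L \<in> Ob C; M \<in> Ob C; N \<in> Ob C; f \<in> mor C L M; g \<in> mor C M N\<rbrakk>
        \<Longrightarrow> ShM C (g \<star> f) = ShM C g \<star> ShM C f"
    and ShM_linear:
      "\<lbrakk>L \<in> Ob C; M \<in> Ob C\<rbrakk> \<Longrightarrow> ShM C \<in> module_hom K (Hom C L M) (Hom C (Sh C L) (Sh C M))"
    and ShM_fully_faithful:
      "\<lbrakk>L \<in> Ob C; M \<in> Ob C\<rbrakk> \<Longrightarrow> bij_betw (ShM C) (mor C L M) (mor C (Sh C L) (Sh C M))"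
    and Sh_essentially_surjective:
      "M \<in> Ob C \<Longrightarrow> \<exists>L \<in> Ob C. \<exists>f. is_iso C (Sh C L) M f"
    and Tri_is_triangle: "t \<in> Tri C \<Longrightarrow> is_triangle C t"
    and TR1_iso_closed:
      "\<lbrakk>(L, M, N, u, v, w) \<in> Tri C; is_triangle C (L', M', N', u', v', w');
        is_iso C L L' f; is_iso C M M' g; is_iso C N N' h;
        g \<star> u = u' \<star> f; h \<star> v = v' \<star> g; ShM C f \<star> w = w' \<star> h\<rbrakk>
        \<Longrightarrow> (L', M', N', u', v', w') \<in> Tri C"
    and TR1_idm:
      "\<lbrakk>L \<in> Ob C; zero_object C N\<rbrakk>
        \<Longrightarrow> (L, L, N, idm C L, \<zero>\<^bsub>Hom C L N\<^esub>, \<zero>\<^bsub>Hom C N (Sh C L)\<^esub>) \<in> Tri C"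
    and TR1_cone:
      "\<lbrakk>L \<in> Ob C; M \<in> Ob C; u \<in> mor C L M\<rbrakk> \<Longrightarrow> \<exists>N v w. (L, M, N, u, v, w) \<in> Tri C"
    and TR2_rotate:
      "is_triangle C (L, M, N, u, v, w) \<Longrightarrow>
        (L, M, N, u, v, w) \<in> Tri C \<longleftrightarrow>
        (M, N, Sh C L, v, w, \<ominus>\<^bsub>Hom C (Sh C L) (Sh C M)\<^esub> (ShM C u)) \<in> Tri C"
    and TR3_morphism:
      "\<lbrakk>(L, M, N, u, v, w) \<in> Tri C; (L', M', N', u', v', w') \<in> Tri C;
        f \<in> mor C L L'; g \<in> mor C M M'; g \<star> u = u' \<star> f\<rbrakk>
        \<Longrightarrow> \<exists>h \<in> mor C N N'. h \<star> v = v' \<star> g \<and> ShM C f \<star> w = w' \<star> h"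
    and TR4_octahedron:
      "\<lbrakk>(L, M, A, u, a, a') \<in> Tri C; (M, N, B, v, b, b') \<in> Tri C;
        (L, N, D, v \<star> u, d, d') \<in> Tri C\<rbrakk>
        \<Longrightarrow> \<exists>f g. (A, D, B, f, g, ShM C a \<star> b') \<in> Tri C \<and>
              f \<star> a = d \<star> v \<and> d' \<star> f = a' \<and> g \<star> d = b \<and> b' \<star> g = ShM C u \<star> d'"


section \<open>2-Calabi--Yau categories and 2-Calabi--Yau-tilted algebras\<close>

text \<open>
  \<open>\<Phi> L M\<close> is the isomorphism from \<open>D Hom(L, M)\<close> to \<open>Hom(M, \<Sigma>\<^sup>2 L)\<close>.  Both sides are covariant
  in \<open>L\<close> and contravariant in \<open>M\<close>.
\<close>

definition two_calabi_yau ::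
  "('k, 'r) ring_scheme \<Rightarrow> ('k, 'o, 'm, 'z) tri_cat_scheme \<Rightarrow> bool" where
  "two_calabi_yau K C \<longleftrightarrow> (\<exists>\<Phi>.
    (\<forall>L \<in> Ob C. \<forall>M \<in> Ob C.
      \<Phi> L M \<in> module_hom K (dual_space K (Hom C L M)) (Hom C M (Sh C (Sh C L))) \<and>
      bij_betw (\<Phi> L M) (carrier (dual_space K (Hom C L M))) (mor C M (Sh C (Sh C L)))) \<and>
    (\<forall>L \<in> Ob C. \<forall>L' \<in> Ob C. \<forall>M \<in> Ob C. \<forall>M' \<in> Ob C.
      \<forall>f \<in> mor C L L'. \<forall>g \<in> mor C M' M. \<forall>\<phi> \<in> carrier (dual_space K (Hom C L M)).
        \<Phi> L' M' (\<lambda>h \<in> mor C L' M'. \<phi> (g \<star>\<^bsub>C\<^esub> h \<star>\<^bsub>C\<^esub> f))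
          = ShM C (ShM C f) \<star>\<^bsub>C\<^esub> \<Phi> L M \<phi> \<star>\<^bsub>C\<^esub> g))"

locale two_CY_category = triangulated_category +
  assumes hom_finite: "hom_finite K C"
    and krull_schmidt: "krull_schmidt C"
    and two_calabi_yau: "two_calabi_yau K C"

definition cluster_tilting :: "('k, 'o, 'm, 'z) tri_cat_scheme \<Rightarrow> 'o \<Rightarrow> bool" where
  "cluster_tilting C T \<longleftrightarrow> T \<in> Ob C \<and> mor C T (Sh C T) = {\<zero>\<^bsub>Hom C T (Sh C T)\<^esub>} \<and>
    (\<forall>L \<in> Ob C. mor C T (Sh C L) = {\<zero>\<^bsub>Hom C T (Sh C L)\<^esub>} \<longrightarrow> in_add C T L)"

text \<open>
  The category ranges over all those with objects in \<open>'o\<close> and morphisms in \<open>'m\<close>; a statement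
  that leaves both type variables free is about categories of arbitrary size.
  Finite-dimensionality of \<open>A\<close> is not repeated, since \<open>hom_finite\<close> and the isomorphism force it.
\<close>

definition two_CY_tilted ::
  "'o itself \<Rightarrow> 'm itself \<Rightarrow> ('k, 'r) ring_scheme \<Rightarrow> ('k, 'a, 'z) module_scheme \<Rightarrow> bool" where
  "two_CY_tilted (_ :: 'o itself) (_ :: 'm itself) K A \<longleftrightarrow>
    (\<exists>(C :: ('k, 'o, 'm) tri_cat) T.
      two_CY_category K C \<and> cluster_tilting C T \<and> algebra_iso K A (End_algebra C T) \<noteq> {})"

end

theory Submission
  imports Defs
begin

text \<open>
  The algebra \<open>\<Gamma>\<close> is the algebra of triangular two by two matrices over \<open>K[x]/(x\<^sup>2)\<close>.  By a theorem of
  Keller and Reiten, the stable category of Gorenstein projective modules over a 2-Calabi--Yau-tilted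
  algebra is 3-Calabi--Yau.  For \<open>\<Gamma>\<close> this category is the orbit category of the derived category of the
  quiver with two vertices and one arrow by its shift, in which the Auslander--Reiten translation permutes the
  three indecomposable objects cyclically instead of fixing them.  The proof below extracts from this failure a
  direct contradiction that needs neither stable categories nor Gorenstein modules.

  Suppose \<open>\<Gamma> = End T\<close> with \<open>T\<close> cluster tilting.  Let \<open>e\<close> be the idempotent at the vertex \<open>2\<close>, let
  \<open>u = \<alpha> + e\<close>, and let \<open>Y\<close> be the cone of \<open>u\<close>.  Then \<open>Hom(T, Y) = \<Gamma>/u\<Gamma>\<close> is concentrated at the
  vertex \<open>1\<close>.  By 2-Calabi--Yau duality, \<open>N = Hom(T, \<Sigma>Y)\<close> is the space of linear forms on \<open>\<Gamma>\<close> that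
  vanish on \<open>\<Gamma>u\<close>; it is generated at the vertex \<open>2\<close> by the coefficient of \<open>\<beta>\<close>, and it has the periodic
  projective resolution given by multiplication by \<open>\<gamma>\<close>.  Its second syzygy is therefore \<open>N\<close> again, up to
  projective summands.

  On the other hand, a left \<open>add T\<close>-approximation of \<open>Y\<close> gives a triangle \<open>Y \<rightarrow> S \<rightarrow> S' \<rightarrow> \<Sigma>Y\<close> with
  \<open>S\<close> and \<open>S'\<close> in \<open>add T\<close>, hence a projective presentation of \<open>N\<close> whose second syzygy is a quotient of
  \<open>Hom(T, Y)\<close> and so vanishes at the vertex \<open>2\<close>.  These two facts are incompatible.  Comparing the two
  presentations by hand, starting from the generator of \<open>N\<close>, only uses a few scalar-free identities in \<open>\<Gamma>\<close>
  and one linear form; they are collected in the locale \<open>tilting_obstruction\<close>, which the lemma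
  \<open>inconsistent\<close> refutes.  The lemma \<open>no_tilting_presentation\<close> verifies them for \<open>\<Gamma>\<close>, mostly from
  \<open>\<gamma>_right_cancel\<close>, \<open>\<gamma>_left\<close> and \<open>I_long\<close>.
\<close>

section \<open>Linear and triangulated categories\<close>

lemma module_hom_zero:
  assumes "f \<in> module_hom K A B" "module K A" "module K B"
  shows "f \<zero>\<^bsub>A\<^esub> = \<zero>\<^bsub>B\<^esub>"
  using mod_hom.f0_is_0[of K A B f] assms by (simp add: mod_hom_def mod_hom_axioms_def)

lemma module_hom_neg:
  assumes "f \<in> module_hom K A B" "module K A" "module K B" "x \<in> carrier A"
  shows "f (\<ominus>\<^bsub>A\<^esub> x) = \<ominus>\<^bsub>B\<^esub> f x"
  using mod_hom.f_neg[of K A B f] assms by (simp add: mod_hom_def mod_hom_axioms_def)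

context linear_category
begin

lemma Hom_module: "L \<in> Ob C \<Longrightarrow> M \<in> Ob C \<Longrightarrow> module K (Hom C L M)"
  using Hom_vectorspace vectorspace_def by blast

lemma Hom_group: "L \<in> Ob C \<Longrightarrow> M \<in> Ob C \<Longrightarrow> abelian_group (Hom C L M)"
  using Hom_module module_def by blast

lemma zero_mor [simp, intro]: "L \<in> Ob C \<Longrightarrow> M \<in> Ob C \<Longrightarrow> \<zero>\<^bsub>Hom C L M\<^esub> \<in> mor C L M"
  by (rule abelian_monoid.zero_closed[OF abelian_group.axioms(1)[OF Hom_group]])

lemma add_mor [simp, intro]:
  "\<lbrakk>L \<in> Ob C; M \<in> Ob C; f \<in> mor C L M; g \<in> mor C L M\<rbrakk> \<Longrightarrow> f \<oplus>\<^bsub>Hom C L M\<^esub> g \<in> mor C L M"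
  by (rule abelian_monoid.a_closed[OF abelian_group.axioms(1)[OF Hom_group]])

lemma neg_mor [simp, intro]:
  "\<lbrakk>L \<in> Ob C; M \<in> Ob C; f \<in> mor C L M\<rbrakk> \<Longrightarrow> \<ominus>\<^bsub>Hom C L M\<^esub> f \<in> mor C L M"
  by (rule abelian_group.a_inv_closed[OF Hom_group])

lemma neg_eq_zero_iff:
  "\<lbrakk>L \<in> Ob C; M \<in> Ob C; f \<in> mor C L M\<rbrakk>
    \<Longrightarrow> \<ominus>\<^bsub>Hom C L M\<^esub> f = \<zero>\<^bsub>Hom C L M\<^esub> \<longleftrightarrow> f = \<zero>\<^bsub>Hom C L M\<^esub>"
proof -
  assume "L \<in> Ob C" "M \<in> Ob C" and f: "f \<in> mor C L M"
  then interpret H: abelian_group "Hom C L M" by (intro Hom_group)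
  show ?thesis using f H.minus_minus[OF f] H.minus_minus[OF H.zero_closed] H.r_neg[OF H.zero_closed]
    H.l_zero[OF H.a_inv_closed[OF H.zero_closed]] by metis
qed

lemma neg_neg: "\<lbrakk>L \<in> Ob C; M \<in> Ob C; f \<in> mor C L M\<rbrakk>
    \<Longrightarrow> \<ominus>\<^bsub>Hom C L M\<^esub> (\<ominus>\<^bsub>Hom C L M\<^esub> f) = f"
  by (rule abelian_group.minus_minus[OF Hom_group])

lemma comp_zero_right:
  assumes "L \<in> Ob C" "M \<in> Ob C" "N \<in> Ob C" "g \<in> mor C M N"
  shows "g \<star> \<zero>\<^bsub>Hom C L M\<^esub> = \<zero>\<^bsub>Hom C L N\<^esub>"
  by (rule module_hom_zero[OF comp_linear_right[OF assms]]) (simp_all add: Hom_module assms)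

lemma comp_zero_left:
  assumes "L \<in> Ob C" "M \<in> Ob C" "N \<in> Ob C" "f \<in> mor C L M"
  shows "\<zero>\<^bsub>Hom C M N\<^esub> \<star> f = \<zero>\<^bsub>Hom C L N\<^esub>"
  by (rule module_hom_zero[OF comp_linear_left[OF assms]]) (simp_all add: Hom_module assms)

lemma comp_neg_right:
  assumes "L \<in> Ob C" "M \<in> Ob C" "N \<in> Ob C" "f \<in> mor C L M" "g \<in> mor C M N"
  shows "g \<star> (\<ominus>\<^bsub>Hom C L M\<^esub> f) = \<ominus>\<^bsub>Hom C L N\<^esub> (g \<star> f)"
  by (rule module_hom_neg[OF comp_linear_right[OF assms(1-3,5)]]) (simp_all add: Hom_module assms)

lemma comp_neg_left:
  assumes "L \<in> Ob C" "M \<in> Ob C" "N \<in> Ob C" "f \<in> mor C L M" "g \<in> mor C M N"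
  shows "(\<ominus>\<^bsub>Hom C M N\<^esub> g) \<star> f = \<ominus>\<^bsub>Hom C L N\<^esub> (g \<star> f)"
  by (rule module_hom_neg[OF comp_linear_left[OF assms(1-4)]]) (simp_all add: Hom_module assms)

lemma comp_add_right:
  assumes "L \<in> Ob C" "M \<in> Ob C" "N \<in> Ob C" "f \<in> mor C L M" "f' \<in> mor C L M" "g \<in> mor C M N"
  shows "g \<star> (f \<oplus>\<^bsub>Hom C L M\<^esub> f') = (g \<star> f) \<oplus>\<^bsub>Hom C L N\<^esub> (g \<star> f')"
  by (rule module_hom_add[OF comp_linear_right[OF assms(1-3,6)]]) (fact assms)+

lemma comp_add_left:
  assumes "L \<in> Ob C" "M \<in> Ob C" "N \<in> Ob C" "f \<in> mor C L M" "g \<in> mor C M N" "g' \<in> mor C M N"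
  shows "(g \<oplus>\<^bsub>Hom C M N\<^esub> g') \<star> f = (g \<star> f) \<oplus>\<^bsub>Hom C L N\<^esub> (g' \<star> f)"
  by (rule module_hom_add[OF comp_linear_left[OF assms(1-4)]]) (fact assms)+

text \<open>
  The identity of a direct sum is a sum of morphisms that factor through the summands.  This
  induction rule is the way in which every additive property below passes from the summands to the sum.
\<close>

lemma direct_sum_induct:
  assumes S: "is_direct_sum C Xs S"
    and zero: "Q \<zero>\<^bsub>Hom C S S\<^esub>"
    and add: "\<And>f g. \<lbrakk>f \<in> mor C S S; g \<in> mor C S S; Q f; Q g\<rbrakk> \<Longrightarrow> Q (f \<oplus>\<^bsub>Hom C S S\<^esub> g)"
    and fact: "\<And>L f g. \<lbrakk>L \<in> set Xs; f \<in> mor C L S; g \<in> mor C S L\<rbrakk> \<Longrightarrow> Q (f \<star> g)"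
  shows "Q (idm C S)"
proof -
  from S obtain \<iota> \<pi> where ob: "set Xs \<subseteq> Ob C" "S \<in> Ob C"
    and ip: "\<And>j. j < length Xs \<Longrightarrow> \<iota> j \<in> mor C (Xs ! j) S \<and> \<pi> j \<in> mor C S (Xs ! j)"
    and sum: "(\<Oplus>\<^bsub>Hom C S S\<^esub> j \<in> {..<length Xs}. \<iota> j \<star> \<pi> j) = idm C S"
    unfolding is_direct_sum_def by blast
  interpret H: abelian_group "Hom C S S" using ob Hom_group by blast
  have mor: "\<iota> j \<star> \<pi> j \<in> mor C S S" if "j < length Xs" for j
    using ip[OF that] ob nth_mem[OF that] by (auto intro: comp_closed)
  have "Q (\<Oplus>\<^bsub>Hom C S S\<^esub> j \<in> J. \<iota> j \<star> \<pi> j)" if "J \<subseteq> {..<length Xs}" for J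
    using finite_subset[OF that finite_lessThan] that
  proof (induction J rule: finite_induct)
    case empty
    then show ?case by (simp add: zero)
  next
    case (insert k J)
    have "(\<Oplus>\<^bsub>Hom C S S\<^esub> j \<in> insert k J. \<iota> j \<star> \<pi> j) =
        (\<iota> k \<star> \<pi> k) \<oplus>\<^bsub>Hom C S S\<^esub> (\<Oplus>\<^bsub>Hom C S S\<^esub> j \<in> J. \<iota> j \<star> \<pi> j)"
      using insert mor by (intro H.finsum_insert) auto
    moreover have "(\<Oplus>\<^bsub>Hom C S S\<^esub> j \<in> J. \<iota> j \<star> \<pi> j) \<in> mor C S S"
      using insert mor by (intro H.finsum_closed) auto
    ultimately show ?case
      using insert mor ip by (auto intro!: add fact)
  qed
  from this[of "{..<length Xs}"] show ?thesis using sum by simp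
qed

lemma direct_sum_Nil_zero_object: "is_direct_sum C [] Z \<Longrightarrow> zero_object C Z"
  using direct_sum_induct[of "[]" Z "\<lambda>f. f = \<zero>\<^bsub>Hom C Z Z\<^esub>"] Hom_group[of Z Z]
  by (auto simp: zero_object_def is_direct_sum_def abelian_group_def abelian_monoid.l_zero)

lemma direct_sum_pair:
  assumes "is_direct_sum C [L, M] S"
  obtains i j p q where "L \<in> Ob C" "M \<in> Ob C" "S \<in> Ob C"
    "i \<in> mor C L S" "j \<in> mor C M S" "p \<in> mor C S L" "q \<in> mor C S M"
    "p \<star> i = idm C L" "q \<star> j = idm C M" "p \<star> j = \<zero>\<^bsub>Hom C M L\<^esub>" "q \<star> i = \<zero>\<^bsub>Hom C L M\<^esub>"
proof -
  from assms obtain \<iota> \<pi> where ob: "set [L, M] \<subseteq> Ob C" "S \<in> Ob C"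
    and ip: "\<And>j. j < length [L, M] \<Longrightarrow> \<iota> j \<in> mor C ([L, M] ! j) S \<and> \<pi> j \<in> mor C S ([L, M] ! j)"
    and d: "\<And>j k. \<lbrakk>j < length [L, M]; k < length [L, M]\<rbrakk> \<Longrightarrow>
       \<pi> j \<star> \<iota> k = (if j = k then idm C ([L, M] ! j) else \<zero>\<^bsub>Hom C ([L, M] ! k) ([L, M] ! j)\<^esub>)"
    unfolding is_direct_sum_def by blast
  show ?thesis
    using that[of "\<iota> 0" "\<iota> 1" "\<pi> 0" "\<pi> 1"] ob ip[of 0] ip[of 1] d[of 0 0] d[of 0 1] d[of 1 0] d[of 1 1]
    by simp
qed

end

context triangulated_category
begin

lemma triangleD:
  assumes "(L, M, N, u, v, w) \<in> Tri C"
  shows "L \<in> Ob C" "M \<in> Ob C" "N \<in> Ob C" "Sh C L \<in> Ob C"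
    "u \<in> mor C L M" "v \<in> mor C M N" "w \<in> mor C N (Sh C L)"
  using Tri_is_triangle[OF assms] Sh_closed by (auto simp: is_triangle_def)

lemma ShM_closed: "\<lbrakk>L \<in> Ob C; M \<in> Ob C; f \<in> mor C L M\<rbrakk> \<Longrightarrow> ShM C f \<in> mor C (Sh C L) (Sh C M)"
  using module_hom_closed[OF ShM_linear] by (simp add: Pi_iff)

lemma ShM_zero: "\<lbrakk>L \<in> Ob C; M \<in> Ob C\<rbrakk> \<Longrightarrow> ShM C \<zero>\<^bsub>Hom C L M\<^esub> = \<zero>\<^bsub>Hom C (Sh C L) (Sh C M)\<^esub>"
  by (rule module_hom_zero[OF ShM_linear]) (simp_all add: Hom_module Sh_closed)

lemma ShM_neg: "\<lbrakk>L \<in> Ob C; M \<in> Ob C; f \<in> mor C L M\<rbrakk>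
    \<Longrightarrow> ShM C (\<ominus>\<^bsub>Hom C L M\<^esub> f) = \<ominus>\<^bsub>Hom C (Sh C L) (Sh C M)\<^esub> ShM C f"
  by (rule module_hom_neg[OF ShM_linear]) (simp_all add: Hom_module Sh_closed)

lemma ShM_full:
  assumes "L \<in> Ob C" "M \<in> Ob C" "f \<in> mor C (Sh C L) (Sh C M)"
  obtains g where "g \<in> mor C L M" "f = ShM C g"
  using ShM_fully_faithful[OF assms(1,2)] assms(3) by (auto simp: bij_betw_def)

lemma ShM_faithful:
  assumes "L \<in> Ob C" "M \<in> Ob C" "f \<in> mor C L M" "g \<in> mor C L M" "ShM C f = ShM C g"
  shows "f = g"
  using ShM_fully_faithful[OF assms(1,2)] assms(3-) by (auto simp: bij_betw_def inj_on_def)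

lemma mor_Sh_trivial_iff:
  assumes "L \<in> Ob C" "M \<in> Ob C"
  shows "mor C (Sh C L) (Sh C M) = {\<zero>\<^bsub>Hom C (Sh C L) (Sh C M)\<^esub>} \<longleftrightarrow> mor C L M = {\<zero>\<^bsub>Hom C L M\<^esub>}"
proof
  assume *: "mor C (Sh C L) (Sh C M) = {\<zero>\<^bsub>Hom C (Sh C L) (Sh C M)\<^esub>}"
  have "f = \<zero>\<^bsub>Hom C L M\<^esub>" if f: "f \<in> mor C L M" for f
  proof (rule ShM_faithful[OF assms f zero_mor[OF assms]])
    show "ShM C f = ShM C \<zero>\<^bsub>Hom C L M\<^esub>"
      using ShM_closed[OF assms f] * ShM_zero[OF assms] by simp
  qed
  with zero_mor[OF assms] show "mor C L M = {\<zero>\<^bsub>Hom C L M\<^esub>}" by blast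
next
  assume *: "mor C L M = {\<zero>\<^bsub>Hom C L M\<^esub>}"
  have "f = \<zero>\<^bsub>Hom C (Sh C L) (Sh C M)\<^esub>" if "f \<in> mor C (Sh C L) (Sh C M)" for f
    using ShM_full[OF assms that] ShM_zero[OF assms] * by (metis singletonD)
  with zero_mor[OF Sh_closed Sh_closed, OF assms]
  show "mor C (Sh C L) (Sh C M) = {\<zero>\<^bsub>Hom C (Sh C L) (Sh C M)\<^esub>}" by blast
qed

lemma zero_object_exists: obtains Z where "zero_object C Z"
  using direct_sums_exist[of "[]"] direct_sum_Nil_zero_object by auto

lemma zero_object_Sh: "zero_object C Z \<Longrightarrow> zero_object C (Sh C Z)"
  unfolding zero_object_def using Sh_closed ShM_idm ShM_zero by metis

lemma rotate:
  assumes "(L, M, N, u, v, w) \<in> Tri C"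
  shows "(M, N, Sh C L, v, w, \<ominus>\<^bsub>Hom C (Sh C L) (Sh C M)\<^esub> (ShM C u)) \<in> Tri C"
  using assms TR2_rotate Tri_is_triangle by blast

text \<open>
  Map the triangle on the identity of \<open>L\<close> to the given one by \<open>idm\<close> and \<open>u\<close>: the third component
  starts at a zero object, so that \<open>v \<star> u\<close> factors through zero.
\<close>

lemma triangle_comp_zero:
  assumes t: "(L, M, N, u, v, w) \<in> Tri C"
  shows "v \<star> u = \<zero>\<^bsub>Hom C L N\<^esub>"
proof -
  note o = triangleD[OF t]
  obtain Z where Z: "zero_object C Z" by (rule zero_object_exists)
  then have ZO: "Z \<in> Ob C" by (simp add: zero_object_def)
  from TR3_morphism[OF TR1_idm[OF o(1) Z] t idm_closed[OF o(1)] o(5)]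
  obtain h where "h \<in> mor C Z N" "h \<star> \<zero>\<^bsub>Hom C L Z\<^esub> = v \<star> u" by blast
  then show ?thesis using comp_zero_right o ZO by metis
qed

lemma triangle_comp_zero':
  assumes t: "(L, M, N, u, v, w) \<in> Tri C"
  shows "w \<star> v = \<zero>\<^bsub>Hom C M (Sh C L)\<^esub>" "ShM C u \<star> w = \<zero>\<^bsub>Hom C N (Sh C M)\<^esub>"
proof -
  note o = triangleD[OF t] Sh_closed
  show "w \<star> v = \<zero>\<^bsub>Hom C M (Sh C L)\<^esub>" using triangle_comp_zero[OF rotate[OF t]] .
  have "(\<ominus>\<^bsub>Hom C (Sh C L) (Sh C M)\<^esub> (ShM C u)) \<star> w = \<zero>\<^bsub>Hom C N (Sh C M)\<^esub>"
    using triangle_comp_zero[OF rotate[OF rotate[OF t]]] .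
  then show "ShM C u \<star> w = \<zero>\<^bsub>Hom C N (Sh C M)\<^esub>"
    using comp_neg_left[of N "Sh C L" "Sh C M" w "ShM C u"]
      neg_eq_zero_iff[of N "Sh C M" "ShM C u \<star> w"] o comp_closed ShM_closed by metis
qed

text \<open>
  Exactness of \<open>Hom(W, -)\<close> at the second vertex.  A morphism of triangles is completed at its third
  vertex, so both triangles are rotated once before \<open>f\<close> and \<open>0\<close> are taken as its first two components;
  the completion is \<open>\<Sigma>g\<close>.  Exactness at the other vertices follows by rotation.
\<close>

lemma triangle_lift:
  assumes t: "(L, M, N, u, v, w) \<in> Tri C"
    and W: "W \<in> Ob C" and f: "f \<in> mor C W M" and vf: "v \<star> f = \<zero>\<^bsub>Hom C W N\<^esub>"
  obtains g where "g \<in> mor C W L" "f = u \<star> g"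
proof -
  note o = triangleD[OF t] Sh_closed
  obtain Z where Z: "zero_object C Z" by (rule zero_object_exists)
  then have ZO: "Z \<in> Ob C" by (simp add: zero_object_def)
  have sq: "\<zero>\<^bsub>Hom C Z N\<^esub> \<star> \<zero>\<^bsub>Hom C W Z\<^esub> = v \<star> f"
    using vf comp_zero_right[of W Z N "\<zero>\<^bsub>Hom C Z N\<^esub>"] W ZO o by simp
  obtain h where h: "h \<in> mor C (Sh C W) (Sh C L)"
    and eq: "ShM C f \<star> (\<ominus>\<^bsub>Hom C (Sh C W) (Sh C W)\<^esub> (ShM C (idm C W))) =
        (\<ominus>\<^bsub>Hom C (Sh C L) (Sh C M)\<^esub> (ShM C u)) \<star> h"
    using TR3_morphism[OF rotate[OF TR1_idm[OF W Z]] rotate[OF t] f zero_mor[OF ZO o(3)] sq] by blast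
  obtain g where g: "g \<in> mor C W L" "h = ShM C g" using ShM_full[OF W o(1) h] .
  have "\<ominus>\<^bsub>Hom C (Sh C W) (Sh C M)\<^esub> (ShM C f) = \<ominus>\<^bsub>Hom C (Sh C W) (Sh C M)\<^esub> (ShM C (u \<star> g))"
    using eq W o f g ShM_closed idm_closed
      comp_neg_right[of "Sh C W" "Sh C W" "Sh C M" "idm C (Sh C W)" "ShM C f"]
      comp_neg_left[of "Sh C W" "Sh C L" "Sh C M" "ShM C g" "ShM C u"]
    by (simp add: ShM_comp[OF W o(1,2)] ShM_idm comp_idm_right[of "Sh C W" "Sh C M"])
  then have "ShM C f = ShM C (u \<star> g)"
    using neg_neg W o f g ShM_closed comp_closed by metis
  then have "f = u \<star> g" using ShM_faithful W o f g comp_closed by metis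
  with g that show ?thesis by blast
qed

text \<open>
  Exactness of \<open>Hom(-, W)\<close> at the second vertex: here \<open>f\<close> is the second component of a morphism to a
  triangle \<open>0 \<rightarrow> W \<rightarrow> W \<rightarrow> \<Sigma>0\<close>.
\<close>

lemma triangle_extend:
  assumes t: "(L, M, N, u, v, w) \<in> Tri C"
    and W: "W \<in> Ob C" and f: "f \<in> mor C M W" and fu: "f \<star> u = \<zero>\<^bsub>Hom C L W\<^esub>"
  obtains g where "g \<in> mor C N W" "f = g \<star> v"
proof -
  note o = triangleD[OF t] Sh_closed
  obtain Z where Z: "zero_object C Z" by (rule zero_object_exists)
  then have ZO: "Z \<in> Ob C" by (simp add: zero_object_def)
  have "\<ominus>\<^bsub>Hom C (Sh C Z) (Sh C W)\<^esub> (ShM C \<zero>\<^bsub>Hom C Z W\<^esub>) = \<zero>\<^bsub>Hom C (Sh C Z) (Sh C W)\<^esub>"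
    using ZO W ShM_zero neg_eq_zero_iff Sh_closed by simp
  then have t0: "(Z, W, W, \<zero>\<^bsub>Hom C Z W\<^esub>, idm C W, \<zero>\<^bsub>Hom C W (Sh C Z)\<^esub>) \<in> Tri C"
    using TR1_idm[OF W zero_object_Sh[OF Z]] TR2_rotate[of Z W W "\<zero>\<^bsub>Hom C Z W\<^esub>" "idm C W"] ZO W idm_closed Sh_closed
    by (simp add: is_triangle_def)
  have sq: "f \<star> u = \<zero>\<^bsub>Hom C Z W\<^esub> \<star> \<zero>\<^bsub>Hom C L Z\<^esub>"
    using fu comp_zero_right[of L Z W "\<zero>\<^bsub>Hom C Z W\<^esub>"] W ZO o by simp
  obtain h where "h \<in> mor C N W" "h \<star> v = idm C W \<star> f"
    using TR3_morphism[OF t t0 zero_mor[OF o(1) ZO] f sq] by blast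
  then show ?thesis using that comp_idm_left[OF o(2) W f] by metis
qed

end

section \<open>Linear forms and the symmetry of extensions\<close>

lemma self_module_module:
  assumes "cring K" shows "module K (self_module K)"
proof -
  interpret cring K by fact
  show ?thesis
  proof (rule module_criteria)
    show "\<forall>v\<in>carrier (self_module K). \<exists>w\<in>carrier (self_module K). v \<oplus>\<^bsub>self_module K\<^esub> w = \<zero>\<^bsub>self_module K\<^esub>"
      using r_neg a_inv_closed by (fastforce simp: self_module_def)
    show "\<forall>v w. v \<in> carrier (self_module K) \<and> w \<in> carrier (self_module K)
        \<longrightarrow> v \<oplus>\<^bsub>self_module K\<^esub> w = w \<oplus>\<^bsub>self_module K\<^esub> v"
      by (simp add: self_module_def a_comm)
  qed (simp_all add: self_module_def is_cring m_assoc a_assoc l_distr r_distr)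
qed

lemma zero_form:
  assumes "module K V"
  shows "(\<lambda>x\<in>carrier V. \<zero>\<^bsub>K\<^esub>) \<in> carrier (dual_space K V)"
proof -
  interpret V: module K V by fact
  interpret S: module K "self_module K" by (rule self_module_module) (rule V.R.is_cring)
  show ?thesis
    by (auto simp: dual_space_def module_hom_def self_module_def)
qed

text \<open>
  An additive map kills the zero form because that form is its own double; in this way the dual space
  need not first be shown to be a module.
\<close>

lemma hom_dual_space_zero:
  assumes "f \<in> module_hom K (dual_space K V) W" "module K V" "abelian_group W"
  shows "f (\<lambda>x\<in>carrier V. \<zero>\<^bsub>K\<^esub>) = \<zero>\<^bsub>W\<^esub>"
proof -
  interpret V: module K V by fact
  interpret W: abelian_group W by fact
  let ?z = "\<lambda>x\<in>carrier V. \<zero>\<^bsub>K\<^esub>"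
  note z = zero_form[OF assms(2)]
  have "?z \<oplus>\<^bsub>dual_space K V\<^esub> ?z = ?z"
    by (auto simp: dual_space_def V.R.func_space_def)
  then have "f ?z \<oplus>\<^bsub>W\<^esub> f ?z = f ?z" using module_hom_add[OF assms(1) z z] by simp
  moreover have "f ?z \<in> carrier W" using module_hom_closed[OF assms(1)] z by blast
  ultimately show ?thesis using W.add.l_cancel_one' by metis
qed

lemma dual_space_precomp:
  assumes \<psi>: "\<psi> \<in> carrier (dual_space K W)" and F: "F \<in> module_hom K V W" and V: "module K V"
  shows "(\<lambda>x\<in>carrier V. \<psi> (F x)) \<in> carrier (dual_space K V)"
proof -
  interpret V: module K V by fact
  have \<psi>': "\<psi> \<in> module_hom K W (self_module K)" using \<psi> by (simp add: dual_space_def)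
  have F': "F x \<in> carrier W" if "x \<in> carrier V" for x using module_hom_closed[OF F] that by blast
  show ?thesis
    using module_hom_closed[OF \<psi>'] F' module_hom_add[OF F] module_hom_add[OF \<psi>']
      module_hom_smult[OF F] module_hom_smult[OF \<psi>']
    by (auto simp: dual_space_def module_hom_def Pi_iff)
qed

text \<open>
  Duality identifies the dual of \<open>Hom(L, \<Sigma>M)\<close> with \<open>Hom(\<Sigma>M, \<Sigma>\<^sup>2L)\<close>, that is, with
  \<open>Hom(M, \<Sigma>L)\<close>.
\<close>

lemma (in two_CY_category) ext_symmetric:
  assumes L: "L \<in> Ob C" and M: "M \<in> Ob C"
    and triv: "mor C L (Sh C M) = {\<zero>\<^bsub>Hom C L (Sh C M)\<^esub>}"
  shows "mor C M (Sh C L) = {\<zero>\<^bsub>Hom C M (Sh C L)\<^esub>}"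
proof -
  let ?V = "Hom C L (Sh C M)" and ?W = "Hom C (Sh C M) (Sh C (Sh C L))"
  have SM: "Sh C M \<in> Ob C" and SL: "Sh C L \<in> Ob C" and SSL: "Sh C (Sh C L) \<in> Ob C"
    using L M Sh_closed by auto
  have V: "module K ?V" and W: "abelian_group ?W"
    using Hom_module Hom_group L SM SSL by auto
  from two_calabi_yau obtain \<Phi> where
    \<Phi>: "\<And>L M. \<lbrakk>L \<in> Ob C; M \<in> Ob C\<rbrakk> \<Longrightarrow>
      \<Phi> L M \<in> module_hom K (dual_space K (Hom C L M)) (Hom C M (Sh C (Sh C L))) \<and>
      bij_betw (\<Phi> L M) (carrier (dual_space K (Hom C L M))) (mor C M (Sh C (Sh C L)))"
    unfolding two_calabi_yau_def by blast
  let ?f = "\<Phi> L (Sh C M)"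
  have "\<phi> = (\<lambda>x\<in>carrier ?V. \<zero>\<^bsub>K\<^esub>)" if "\<phi> \<in> carrier (dual_space K ?V)" for \<phi>
  proof -
    have h: "\<phi> \<in> module_hom K ?V (self_module K)" and ext: "\<phi> \<in> extensional (carrier ?V)"
      using that by (auto simp: dual_space_def)
    have "cring K" using V by (simp add: module_def)
    then have "\<phi> \<zero>\<^bsub>?V\<^esub> = \<zero>\<^bsub>K\<^esub>"
      using module_hom_zero[OF h V self_module_module] by (simp add: self_module_def)
    then show ?thesis using ext by (intro extensionalityI[OF ext]) (auto simp: triv)
  qed
  then have "carrier (dual_space K ?V) = {\<lambda>x\<in>carrier ?V. \<zero>\<^bsub>K\<^esub>}"
    using zero_form[OF V] by blast
  moreover have "?f (\<lambda>x\<in>carrier ?V. \<zero>\<^bsub>K\<^esub>) = \<zero>\<^bsub>?W\<^esub>"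
    using hom_dual_space_zero[OF _ V W] \<Phi>[OF L SM] by blast
  ultimately have "carrier ?W = {\<zero>\<^bsub>?W\<^esub>}"
    using \<Phi>[OF L SM] by (auto simp: bij_betw_def)
  then show ?thesis using mor_Sh_trivial_iff[OF M SL] by simp
qed

section \<open>An obstruction to being an endomorphism algebra of a cluster tilting object\<close>

text \<open>
  These are the properties of \<open>\<Gamma>\<close> that rule out a cluster tilting object.  The intended elements are
  the idempotent \<open>e\<close> at the vertex \<open>2\<close>, the loop \<open>\<gamma>\<close> and \<open>u = \<alpha> + e\<close>; the form \<open>\<phi>\<close> is
  the coefficient of \<open>\<beta>\<close>.  The summand \<open>e\<close> makes \<open>u\<close> act invertibly at the vertex \<open>2\<close>, so that its
  cone is the cone of \<open>\<alpha>\<close> on the summand of \<open>T\<close> at the vertex \<open>1\<close>, without any need to split \<open>T\<close>.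
\<close>

locale tilting_obstruction = two_CY_category K C
  for K :: "('k, 'r) ring_scheme" and C :: "('k, 'o, 'm, 'z) tri_cat_scheme" (structure) +
  fixes T :: 'o and e u \<gamma> :: 'm and \<phi> :: "'m \<Rightarrow> 'k"
  assumes tilting: "cluster_tilting C T"
    and End [simp, intro]: "e \<in> mor C T T" "u \<in> mor C T T" "\<gamma> \<in> mor C T T"
    and idem: "e \<star> e = e" and corner: "x \<in> mor C T T \<Longrightarrow> x \<star> e = e \<star> (x \<star> e)"
    and u_e: "u \<star> e = e" and \<gamma>_e: "\<gamma> \<star> e = \<gamma>" and \<gamma>_\<gamma>: "\<gamma> \<star> \<gamma> = \<zero>\<^bsub>Hom C T T\<^esub>"
    and \<gamma>_exact: "\<lbrakk>x \<in> mor C T T; x \<star> \<gamma> = \<zero>\<^bsub>Hom C T T\<^esub>\<rbrakk> \<Longrightarrow> \<exists>y \<in> mor C T T. x \<star> e = y \<star> \<gamma>"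
    and \<gamma>_u: "x \<in> mor C T T \<Longrightarrow> \<exists>y \<in> mor C T T. \<gamma> \<star> x = y \<star> u"
    and form: "\<phi> \<in> carrier (dual_space K (Hom C T T))"
    and form_u: "x \<in> mor C T T \<Longrightarrow> \<phi> (x \<star> u) = \<zero>\<^bsub>K\<^esub>"
    and form_e: "\<exists>x \<in> mor C T T. \<phi> (e \<star> x) \<noteq> \<zero>\<^bsub>K\<^esub>"
begin

lemma T_Ob [simp, intro]: "T \<in> Ob C"
  using tilting by (simp add: cluster_tilting_def)

lemma T_rigid: "mor C T (Sh C T) = {\<zero>\<^bsub>Hom C T (Sh C T)\<^esub>}"
  using tilting by (simp add: cluster_tilting_def)

text \<open>
  The only consequences of \<open>S\<close> lying in \<open>add T\<close> that the argument uses.  The last one says that the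
  complex of right multiplications by \<open>\<gamma>\<close> on the \<open>e\<close>-part of \<open>Hom(T, S)\<close> is exact.
\<close>

definition T_like :: "'o \<Rightarrow> bool" where
  "T_like S \<longleftrightarrow> S \<in> Ob C \<and> mor C T (Sh C S) = {\<zero>\<^bsub>Hom C T (Sh C S)\<^esub>} \<and>
    (\<forall>f \<in> mor C T S. f \<star> \<gamma> = \<zero>\<^bsub>Hom C T S\<^esub> \<longrightarrow> (\<exists>y \<in> mor C T S. f \<star> e = y \<star> \<gamma>))"

lemma T_like_T: "T_like T"
  using T_rigid \<gamma>_exact by (auto simp: T_like_def)

lemma T_like_rigid: "T_like S \<Longrightarrow> mor C S (Sh C T) = {\<zero>\<^bsub>Hom C S (Sh C T)\<^esub>}"
  using ext_symmetric[of T S] by (simp add: T_like_def)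

lemma T_like_direct_sum:
  assumes S: "is_direct_sum C Xs S" and T_like: "\<And>L. L \<in> set Xs \<Longrightarrow> T_like L"
  shows "T_like S"
  unfolding T_like_def
proof (intro conjI ballI impI)
  show SO [simp]: "S \<in> Ob C" using S by (simp add: is_direct_sum_def)
  have SS [simp]: "Sh C S \<in> Ob C" by (simp add: Sh_closed)
  have "f = \<zero>\<^bsub>Hom C T (Sh C S)\<^esub>" if f: "f \<in> mor C T (Sh C S)" for f
  proof -
    have "ShM C (idm C S) \<star> f = \<zero>\<^bsub>Hom C T (Sh C S)\<^esub>"
      using S
    proof (rule direct_sum_induct[where Q = "\<lambda>s. ShM C s \<star> f = \<zero>\<^bsub>Hom C T (Sh C S)\<^esub>"])
      show "ShM C \<zero>\<^bsub>Hom C S S\<^esub> \<star> f = \<zero>\<^bsub>Hom C T (Sh C S)\<^esub>"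
        using comp_zero_left[OF T_Ob SS SS f] by (simp add: ShM_zero)
    next
      fix s t assume st: "s \<in> mor C S S" "t \<in> mor C S S"
        "ShM C s \<star> f = \<zero>\<^bsub>Hom C T (Sh C S)\<^esub>" "ShM C t \<star> f = \<zero>\<^bsub>Hom C T (Sh C S)\<^esub>"
      interpret H: abelian_group "Hom C T (Sh C S)" by (simp add: Hom_group)
      show "ShM C (s \<oplus>\<^bsub>Hom C S S\<^esub> t) \<star> f = \<zero>\<^bsub>Hom C T (Sh C S)\<^esub>"
        using st comp_add_left[OF T_Ob SS SS f, of "ShM C s" "ShM C t"]
          module_hom_add[OF ShM_linear[OF SO SO], of s t] by (simp add: ShM_closed)
    next
      fix L i p assume L: "L \<in> set Xs" and i: "i \<in> mor C L S" and p: "p \<in> mor C S L"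
      have LO: "L \<in> Ob C" and SL: "Sh C L \<in> Ob C"
        and triv: "mor C T (Sh C L) = {\<zero>\<^bsub>Hom C T (Sh C L)\<^esub>}"
        using T_like[OF L] Sh_closed by (auto simp: T_like_def)
      have pf: "ShM C p \<star> f \<in> mor C T (Sh C L)"
        using comp_closed[OF T_Ob SS SL f] ShM_closed[OF SO LO p] by blast
      have "ShM C (i \<star> p) \<star> f = ShM C i \<star> (ShM C p \<star> f)"
        using ShM_comp[OF SO LO SO p i] comp_assoc[OF T_Ob SS SL SS f] ShM_closed[OF SO LO p]
          ShM_closed[OF LO SO i] by simp
      also have "\<dots> = \<zero>\<^bsub>Hom C T (Sh C S)\<^esub>"
        using pf triv comp_zero_right[OF T_Ob SL SS ShM_closed[OF LO SO i]] by simp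
      finally show "ShM C (i \<star> p) \<star> f = \<zero>\<^bsub>Hom C T (Sh C S)\<^esub>" .
    qed
    then show ?thesis using comp_idm_left[OF T_Ob SS f] by (simp add: ShM_idm)
  qed
  then show "mor C T (Sh C S) = {\<zero>\<^bsub>Hom C T (Sh C S)\<^esub>}" using zero_mor[OF T_Ob SS] by blast
next
  fix f assume f: "f \<in> mor C T S" and f\<gamma>: "f \<star> \<gamma> = \<zero>\<^bsub>Hom C T S\<^esub>"
  have SO [simp]: "S \<in> Ob C" using S by (simp add: is_direct_sum_def)
  have "\<exists>y \<in> mor C T S. (idm C S \<star> f) \<star> e = y \<star> \<gamma>"
    using S
  proof (rule direct_sum_induct[where Q = "\<lambda>s. \<exists>y \<in> mor C T S. (s \<star> f) \<star> e = y \<star> \<gamma>"])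
    show "\<exists>y\<in>mor C T S. (\<zero>\<^bsub>Hom C S S\<^esub> \<star> f) \<star> e = y \<star> \<gamma>"
      using comp_zero_left[OF T_Ob SO SO f] comp_zero_left[OF T_Ob T_Ob SO] f
      by (intro bexI[of _ "\<zero>\<^bsub>Hom C T S\<^esub>"]) simp_all
  next
    fix s t assume st: "s \<in> mor C S S" "t \<in> mor C S S"
      and "\<exists>y\<in>mor C T S. (s \<star> f) \<star> e = y \<star> \<gamma>" "\<exists>y\<in>mor C T S. (t \<star> f) \<star> e = y \<star> \<gamma>"
    then obtain y y' where y: "y \<in> mor C T S" "(s \<star> f) \<star> e = y \<star> \<gamma>"
      and y': "y' \<in> mor C T S" "(t \<star> f) \<star> e = y' \<star> \<gamma>" by blast
    have "((s \<oplus>\<^bsub>Hom C S S\<^esub> t) \<star> f) \<star> e = (y \<oplus>\<^bsub>Hom C T S\<^esub> y') \<star> \<gamma>"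
      unfolding comp_add_left[OF T_Ob SO SO f st] comp_add_left[OF T_Ob T_Ob SO End(3) y(1) y'(1)]
        comp_add_left[OF T_Ob T_Ob SO End(1) comp_closed[OF T_Ob SO SO f st(1)] comp_closed[OF T_Ob SO SO f st(2)]]
        y(2) y'(2) by (rule refl)
    then show "\<exists>y\<in>mor C T S. ((s \<oplus>\<^bsub>Hom C S S\<^esub> t) \<star> f) \<star> e = y \<star> \<gamma>"
      by (rule bexI[OF _ add_mor[OF T_Ob SO y(1) y'(1)]])
  next
    fix L i p assume L: "L \<in> set Xs" and i: "i \<in> mor C L S" and p: "p \<in> mor C S L"
    have LO: "L \<in> Ob C" using T_like[OF L] by (simp add: T_like_def)
    have pf: "p \<star> f \<in> mor C T L" using comp_closed[OF T_Ob SO LO f p] .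
    have "(p \<star> f) \<star> \<gamma> = \<zero>\<^bsub>Hom C T L\<^esub>"
      using comp_assoc[OF T_Ob T_Ob SO LO End(3) f p] f\<gamma> comp_zero_right[OF T_Ob SO LO p] by simp
    then obtain y where y: "y \<in> mor C T L" "(p \<star> f) \<star> e = y \<star> \<gamma>"
      using T_like[OF L] pf by (auto simp: T_like_def)
    have "((i \<star> p) \<star> f) \<star> e = i \<star> ((p \<star> f) \<star> e)"
      using comp_assoc[OF T_Ob SO LO SO f p i] comp_assoc[OF T_Ob T_Ob LO SO End(1) pf i] by simp
    also have "\<dots> = (i \<star> y) \<star> \<gamma>"
      using y comp_assoc[OF T_Ob T_Ob LO SO End(3) y(1) i] by simp
    finally show "\<exists>y\<in>mor C T S. ((i \<star> p) \<star> f) \<star> e = y \<star> \<gamma>"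
      using comp_closed[OF T_Ob LO SO y(1) i] by blast
  qed
  then show "\<exists>y\<in>mor C T S. f \<star> e = y \<star> \<gamma>" using comp_idm_left[OF T_Ob SO f] by simp
qed

lemma T_like_summand:
  assumes S: "is_direct_sum C [L, L'] S" and T_like: "T_like S"
  shows "T_like L"
  using S
proof (rule direct_sum_pair)
  fix i p
  assume LO: "L \<in> Ob C" and SO: "S \<in> Ob C"
    and i: "i \<in> mor C L S" and p: "p \<in> mor C S L" and pi: "p \<star> i = idm C L"
  have SS: "Sh C S \<in> Ob C" and SL: "Sh C L \<in> Ob C" using SO LO Sh_closed by auto
  note Si = ShM_closed[OF LO SO i] and Sp = ShM_closed[OF SO LO p]
  have "f = \<zero>\<^bsub>Hom C T (Sh C L)\<^esub>" if f: "f \<in> mor C T (Sh C L)" for f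
  proof -
    have "f = (ShM C p \<star> ShM C i) \<star> f"
      using ShM_comp[OF LO SO LO i p] pi ShM_idm[OF LO] comp_idm_left[OF T_Ob SL f] by simp
    also have "\<dots> = ShM C p \<star> (ShM C i \<star> f)" by (rule comp_assoc[OF T_Ob SL SS SL f Si Sp])
    also have "ShM C i \<star> f = \<zero>\<^bsub>Hom C T (Sh C S)\<^esub>"
      using T_like comp_closed[OF T_Ob SL SS f Si] by (auto simp: T_like_def)
    finally show ?thesis using comp_zero_right[OF T_Ob SS SL Sp] by simp
  qed
  then have triv: "mor C T (Sh C L) = {\<zero>\<^bsub>Hom C T (Sh C L)\<^esub>}" using zero_mor[OF T_Ob SL] by blast
  have "\<exists>y\<in>mor C T L. f \<star> e = y \<star> \<gamma>" if f: "f \<in> mor C T L" and f\<gamma>: "f \<star> \<gamma> = \<zero>\<^bsub>Hom C T L\<^esub>" for f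
  proof -
    have if': "i \<star> f \<in> mor C T S" using comp_closed[OF T_Ob LO SO f i] .
    have "(i \<star> f) \<star> \<gamma> = \<zero>\<^bsub>Hom C T S\<^esub>"
      using comp_assoc[OF T_Ob T_Ob LO SO End(3) f i] f\<gamma> comp_zero_right[OF T_Ob LO SO i] by simp
    then obtain y where y: "y \<in> mor C T S" "(i \<star> f) \<star> e = y \<star> \<gamma>"
      using T_like if' by (auto simp: T_like_def)
    have "f \<star> e = (p \<star> (i \<star> f)) \<star> e"
      using comp_assoc[OF T_Ob LO SO LO f i p] pi comp_idm_left[OF T_Ob LO f] by simp
    also have "\<dots> = (p \<star> y) \<star> \<gamma>"
      using comp_assoc[OF T_Ob T_Ob SO LO End(1) if' p] comp_assoc[OF T_Ob T_Ob SO LO End(3) y(1) p] y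
      by simp
    finally show ?thesis using comp_closed[OF T_Ob SO LO y(1) p] by blast
  qed
  with triv LO show ?thesis by (simp add: T_like_def)
qed

lemma in_add_T_like: "in_add C T L \<Longrightarrow> T_like L"
  unfolding in_add_def using T_like_direct_sum T_like_summand T_like_T
  by (metis in_set_replicate)

text \<open>
  This is where the maximality of a cluster tilting object enters.
\<close>

lemma T_like_if_rigid:
  assumes "L \<in> Ob C" "mor C L (Sh C T) = {\<zero>\<^bsub>Hom C L (Sh C T)\<^esub>}"
  shows "T_like L"
  using tilting ext_symmetric[OF assms(1) T_Ob assms(2)] assms(1) in_add_T_like
  by (simp add: cluster_tilting_def)

text \<open>
  Left approximations by \<open>add T\<close> exist because \<open>Hom(Y, T)\<close> is finite-dimensional: the sum of copies
  of \<open>T\<close> over a finite generating set is built up one generator at a time.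
\<close>

lemma approximation:
  assumes Y: "Y \<in> Ob C"
  obtains S a where "T_like S" "a \<in> mor C Y S" "\<And>h. h \<in> mor C Y T \<Longrightarrow> \<exists>m \<in> mor C S T. h = m \<star> a"
proof -
  interpret V: vectorspace K "Hom C Y T" using Y by (simp add: Hom_vectorspace)
  have "V.fin_dim" using hom_finite Y by (simp add: hom_finite_def)
  then obtain A where A: "finite A" "A \<subseteq> mor C Y T" "V.span A = mor C Y T"
    unfolding V.fin_dim_def by metis
  have "\<exists>S a. T_like S \<and> a \<in> mor C Y S \<and> (\<forall>h \<in> A. \<exists>m \<in> mor C S T. h = m \<star> a)"
    using A(1,2)
  proof (induction A rule: finite_induct)
    case empty
    obtain Z where "is_direct_sum C [] Z" using direct_sums_exist[of "[]"] by auto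
    then have "T_like Z" using T_like_direct_sum[of "[]"] by simp
    then show ?case using zero_mor[OF Y] by (auto simp: T_like_def)
  next
    case (insert h A)
    then obtain S a where S: "T_like S" and a: "a \<in> mor C Y S"
      and lift: "\<And>x. x \<in> A \<Longrightarrow> \<exists>m \<in> mor C S T. x = m \<star> a" by blast
    have h: "h \<in> mor C Y T" and SO: "S \<in> Ob C" using insert S by (auto simp: T_like_def)
    obtain S' where S': "is_direct_sum C [S, T] S'" using direct_sums_exist[of "[S, T]"] SO by auto
    obtain i j p q where SO': "S' \<in> Ob C"
      and i: "i \<in> mor C S S'" and j: "j \<in> mor C T S'" and p: "p \<in> mor C S' S" and q: "q \<in> mor C S' T"
      and pi: "p \<star> i = idm C S" and qj: "q \<star> j = idm C T"
      and pj: "p \<star> j = \<zero>\<^bsub>Hom C T S\<^esub>" and qi: "q \<star> i = \<zero>\<^bsub>Hom C S T\<^esub>"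
      by (rule direct_sum_pair[OF S'])
    define a' where "a' = (i \<star> a) \<oplus>\<^bsub>Hom C Y S'\<^esub> (j \<star> h)"
    have ia: "i \<star> a \<in> mor C Y S'" and jh: "j \<star> h \<in> mor C Y S'"
      using comp_closed[OF Y SO SO' a i] comp_closed[OF Y T_Ob SO' h j] by auto
    have a': "a' \<in> mor C Y S'" unfolding a'_def using add_mor[OF Y SO' ia jh] .
    have pa: "p \<star> a' = a"
    proof -
      interpret H: abelian_group "Hom C Y S" using Y SO by (rule Hom_group)
      have "p \<star> (i \<star> a) = a"
        using comp_assoc[OF Y SO SO' SO a i p] pi comp_idm_left[OF Y SO a] by metis
      moreover have "p \<star> (j \<star> h) = \<zero>\<^bsub>Hom C Y S\<^esub>"
        using comp_assoc[OF Y T_Ob SO' SO h j p] pj comp_zero_left[OF Y T_Ob SO h] by metis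
      ultimately show ?thesis
        unfolding a'_def comp_add_right[OF Y SO' SO ia jh p] using a by simp
    qed
    have qa: "q \<star> a' = h"
    proof -
      interpret H: abelian_group "Hom C Y T" using Y T_Ob by (rule Hom_group)
      have "q \<star> (j \<star> h) = h"
        using comp_assoc[OF Y T_Ob SO' T_Ob h j q] qj comp_idm_left[OF Y T_Ob h] by metis
      moreover have "q \<star> (i \<star> a) = \<zero>\<^bsub>Hom C Y T\<^esub>"
        using comp_assoc[OF Y SO SO' T_Ob a i q] qi comp_zero_left[OF Y SO T_Ob a] by metis
      ultimately show ?thesis
        unfolding a'_def comp_add_right[OF Y SO' T_Ob ia jh q] using h by simp
    qed
    have "\<exists>m \<in> mor C S' T. x = m \<star> a'" if x: "x \<in> A" for x
    proof -
      obtain m where m: "m \<in> mor C S T" "x = m \<star> a" using lift[OF x] by blast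
      then have "x = (m \<star> p) \<star> a'" using pa comp_assoc[OF Y SO' SO T_Ob a' p m(1)] by simp
      then show ?thesis using comp_closed[OF SO' SO T_Ob p m(1)] by blast
    qed
    moreover have "\<exists>m \<in> mor C S' T. h = m \<star> a'" using qa q by auto
    moreover have "T_like S'" using T_like_direct_sum[OF S'] S T_like_T by auto
    ultimately show ?case using a' by blast
  qed
  then obtain S a where S: "T_like S" and a: "a \<in> mor C Y S"
    and lift: "\<And>h. h \<in> A \<Longrightarrow> \<exists>m \<in> mor C S T. h = m \<star> a" by blast
  have SO: "S \<in> Ob C" using S by (simp add: T_like_def)
  interpret pre: mod_hom K "Hom C S T" "Hom C Y T" "\<lambda>m. m \<star> a"
    using comp_linear_left[OF Y SO T_Ob a] Hom_module Y SO
    by (simp add: mod_hom_def mod_hom_axioms_def)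
  have "mor C Y T \<subseteq> pre.im"
    unfolding A(3)[symmetric]
  proof (rule V.span_is_subset)
    show "A \<subseteq> pre.im" using lift by (auto simp: pre.im_def)
  qed (rule pre.im_is_submodule)
  then show ?thesis using that[OF S a] by (auto simp: pre.im_def)
qed

text \<open>
  The case \<open>L = M = T\<close> of duality, a bimodule isomorphism from the dual of \<open>End T\<close> to
  \<open>Hom(T, \<Sigma>\<^sup>2T)\<close>, with naturality split into its two one-sided halves.
\<close>

lemma duality:
  obtains \<Phi> where
    "\<And>\<psi>. \<psi> \<in> carrier (dual_space K (Hom C T T)) \<Longrightarrow> \<Phi> \<psi> \<in> mor C T (Sh C (Sh C T))"
    "\<And>f. f \<in> mor C T (Sh C (Sh C T)) \<Longrightarrow> \<exists>\<psi> \<in> carrier (dual_space K (Hom C T T)). f = \<Phi> \<psi>"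
    "inj_on \<Phi> (carrier (dual_space K (Hom C T T)))"
    "\<Phi> (\<lambda>h\<in>mor C T T. \<zero>\<^bsub>K\<^esub>) = \<zero>\<^bsub>Hom C T (Sh C (Sh C T))\<^esub>"
    "\<And>\<psi> x. \<lbrakk>\<psi> \<in> carrier (dual_space K (Hom C T T)); x \<in> mor C T T\<rbrakk>
      \<Longrightarrow> \<Phi> \<psi> \<star> x = \<Phi> (\<lambda>h\<in>mor C T T. \<psi> (x \<star> h))"
    "\<And>\<psi> x. \<lbrakk>\<psi> \<in> carrier (dual_space K (Hom C T T)); x \<in> mor C T T\<rbrakk>
      \<Longrightarrow> ShM C (ShM C x) \<star> \<Phi> \<psi> = \<Phi> (\<lambda>h\<in>mor C T T. \<psi> (h \<star> x))"
proof -
  let ?D = "carrier (dual_space K (Hom C T T))"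
  have ST: "Sh C T \<in> Ob C" and SST: "Sh C (Sh C T) \<in> Ob C" using Sh_closed by auto
  from two_calabi_yau obtain \<Phi> where
    \<Phi>: "\<And>L M. \<lbrakk>L \<in> Ob C; M \<in> Ob C\<rbrakk> \<Longrightarrow>
      \<Phi> L M \<in> module_hom K (dual_space K (Hom C L M)) (Hom C M (Sh C (Sh C L))) \<and>
      bij_betw (\<Phi> L M) (carrier (dual_space K (Hom C L M))) (mor C M (Sh C (Sh C L)))" and
    nat: "\<And>L L' M M' f g \<phi>. \<lbrakk>L \<in> Ob C; L' \<in> Ob C; M \<in> Ob C; M' \<in> Ob C; f \<in> mor C L L';
      g \<in> mor C M' M; \<phi> \<in> carrier (dual_space K (Hom C L M))\<rbrakk> \<Longrightarrow>
        \<Phi> L' M' (\<lambda>h \<in> mor C L' M'. \<phi> (g \<star> h \<star> f)) = ShM C (ShM C f) \<star> \<Phi> L M \<phi> \<star> g"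
    unfolding two_calabi_yau_def by metis
  note \<Phi>T = \<Phi>[OF T_Ob T_Ob]
  have mem: "\<Phi> T T \<psi> \<in> mor C T (Sh C (Sh C T))" if "\<psi> \<in> ?D" for \<psi>
    using \<Phi>T that by (auto simp: bij_betw_def)
  show ?thesis
  proof (rule that[of "\<Phi> T T"])
    show "\<Phi> T T (\<lambda>h\<in>mor C T T. \<zero>\<^bsub>K\<^esub>) = \<zero>\<^bsub>Hom C T (Sh C (Sh C T))\<^esub>"
      using hom_dual_space_zero[OF _ Hom_module[OF T_Ob T_Ob] Hom_group[OF T_Ob SST]] \<Phi>T by blast
  next
    fix \<psi> x assume \<psi>: "\<psi> \<in> ?D" and x: "x \<in> mor C T T"
    have "\<Phi> T T (\<lambda>h\<in>mor C T T. \<psi> (x \<star> h \<star> idm C T)) = ShM C (ShM C (idm C T)) \<star> (\<Phi> T T \<psi> \<star> x)"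
      using nat[OF T_Ob T_Ob T_Ob T_Ob idm_closed[OF T_Ob] x \<psi>] .
    moreover have "(\<lambda>h\<in>mor C T T. \<psi> (x \<star> h \<star> idm C T)) = (\<lambda>h\<in>mor C T T. \<psi> (x \<star> h))"
      by (rule restrict_ext) (simp add: comp_idm_right[OF T_Ob T_Ob])
    moreover have "ShM C (ShM C (idm C T)) = idm C (Sh C (Sh C T))"
      using ShM_idm[OF T_Ob] ShM_idm[OF ST] by simp
    moreover note comp_idm_left[OF T_Ob SST comp_closed[OF T_Ob T_Ob SST x mem[OF \<psi>]]]
    ultimately show "\<Phi> T T \<psi> \<star> x = \<Phi> T T (\<lambda>h\<in>mor C T T. \<psi> (x \<star> h))" by simp
  next
    fix \<psi> x assume \<psi>: "\<psi> \<in> ?D" and x: "x \<in> mor C T T"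
    have "\<Phi> T T (\<lambda>h\<in>mor C T T. \<psi> (idm C T \<star> h \<star> x)) = ShM C (ShM C x) \<star> (\<Phi> T T \<psi> \<star> idm C T)"
      using nat[OF T_Ob T_Ob T_Ob T_Ob x idm_closed[OF T_Ob] \<psi>] .
    moreover have "(\<lambda>h\<in>mor C T T. \<psi> (idm C T \<star> h \<star> x)) = (\<lambda>h\<in>mor C T T. \<psi> (h \<star> x))"
    proof (rule restrict_ext)
      fix h assume "h \<in> mor C T T"
      then show "\<psi> (idm C T \<star> h \<star> x) = \<psi> (h \<star> x)"
        using comp_idm_left[OF T_Ob T_Ob comp_closed[OF T_Ob T_Ob T_Ob x]] by simp
    qed
    moreover note comp_idm_right[OF T_Ob SST mem[OF \<psi>]]
    ultimately show "ShM C (ShM C x) \<star> \<Phi> T T \<psi> = \<Phi> T T (\<lambda>h\<in>mor C T T. \<psi> (h \<star> x))" by simp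
  qed (use mem \<Phi>T in \<open>auto simp: bij_betw_def\<close>)
qed

text \<open>
  Let \<open>Y\<close> be the cone of \<open>u\<close>.  Duality describes \<open>Hom(T, \<Sigma>Y)\<close> by the forms that vanish on
  \<open>(End T) u\<close>; it contains a nonzero element \<open>z = z \<star> e\<close> given by \<open>\<phi>\<close>, and all of it is killed by
  \<open>\<gamma>\<close>.  An approximation triangle \<open>Y \<rightarrow> S \<rightarrow> S' \<rightarrow> \<Sigma>Y\<close> with \<open>S\<close>, \<open>S'\<close> in \<open>add T\<close> presents
  \<open>Hom(T, \<Sigma>Y)\<close>; comparing it with the periodic complex of multiplications by \<open>\<gamma>\<close> shows that
  \<open>z\<close> is a multiple of \<open>\<gamma>\<close>, hence zero.
\<close>

lemma inconsistent: False
proof -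
  obtain Y p q where t: "(T, T, Y, u, p, q) \<in> Tri C"
    using TR1_cone[OF T_Ob T_Ob End(2)] by blast
  note to = triangleD[OF t]
  have ST: "Sh C T \<in> Ob C" and SST: "Sh C (Sh C T) \<in> Ob C" and SY: "Sh C Y \<in> Ob C"
    using Sh_closed to by auto
  obtain S a where S: "T_like S" and a: "a \<in> mor C Y S"
    and ext: "\<And>h. h \<in> mor C Y T \<Longrightarrow> \<exists>m \<in> mor C S T. h = m \<star> a"
    using approximation[OF to(3)] by blast
  have SO: "S \<in> Ob C" and SS: "Sh C S \<in> Ob C" using S Sh_closed by (auto simp: T_like_def)
  obtain S' d c where t': "(Y, S, S', a, d, c) \<in> Tri C"
    using TR1_cone[OF to(3) SO a] by blast
  note to' = triangleD[OF t']

  \<comment> \<open>\<open>S'\<close> has no extensions by \<open>T\<close>: a map \<open>S' \<rightarrow> \<Sigma>T\<close> factors through \<open>\<Sigma>Y\<close>, hence by the approximation through \<open>\<Sigma>a \<star> c = 0\<close>\<close>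
  have "f = \<zero>\<^bsub>Hom C S' (Sh C T)\<^esub>" if f: "f \<in> mor C S' (Sh C T)" for f
  proof -
    have "f \<star> d = \<zero>\<^bsub>Hom C S (Sh C T)\<^esub>"
      using T_like_rigid[OF S] comp_closed[OF to'(2,3) ST to'(6) f] by auto
    then obtain g where g: "g \<in> mor C (Sh C Y) (Sh C T)" "f = g \<star> c"
      using triangle_extend[OF rotate[OF t'] ST f] by blast
    obtain h where h: "h \<in> mor C Y T" "g = ShM C h" using ShM_full[OF to(3) T_Ob g(1)] .
    obtain m where m: "m \<in> mor C S T" "h = m \<star> a" using ext[OF h(1)] by blast
    have "f = (ShM C m \<star> ShM C a) \<star> c"
      using g h m ShM_comp[OF to(3) SO T_Ob a m(1)] by simp
    also have "\<dots> = ShM C m \<star> (ShM C a \<star> c)"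
      by (rule comp_assoc[OF to'(3) SY SS ST to'(7)]) (use ShM_closed to(3) SO T_Ob a m in auto)
    also have "\<dots> = \<zero>\<^bsub>Hom C S' (Sh C T)\<^esub>"
      unfolding triangle_comp_zero'(2)[OF t']
      by (rule comp_zero_right[OF to'(3) SS ST ShM_closed[OF SO T_Ob m(1)]])
    finally show ?thesis .
  qed
  then have S': "T_like S'" using T_like_if_rigid[OF to'(3)] zero_mor[OF to'(3) ST] by blast

  \<comment> \<open>rotating four times negates \<open>\<Sigma>p\<close> and \<open>\<Sigma>q\<close> once and \<open>\<Sigma>\<^sup>2u\<close> twice\<close>
  define r where "r = \<ominus>\<^bsub>Hom C (Sh C Y) (Sh C (Sh C T))\<^esub> (ShM C q)"
  have t3: "(Sh C T, Sh C Y, Sh C (Sh C T), \<ominus>\<^bsub>Hom C (Sh C T) (Sh C Y)\<^esub> (ShM C p), r, ShM C (ShM C u)) \<in> Tri C"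
  proof -
    have "ShM C (\<ominus>\<^bsub>Hom C (Sh C T) (Sh C T)\<^esub> ShM C u) = \<ominus>\<^bsub>Hom C (Sh C (Sh C T)) (Sh C (Sh C T))\<^esub> ShM C (ShM C u)"
      by (rule ShM_neg[OF ST ST ShM_closed[OF T_Ob T_Ob End(2)]])
    then have "\<ominus>\<^bsub>Hom C (Sh C (Sh C T)) (Sh C (Sh C T))\<^esub> ShM C (\<ominus>\<^bsub>Hom C (Sh C T) (Sh C T)\<^esub> ShM C u) = ShM C (ShM C u)"
      using neg_neg[OF SST SST ShM_closed[OF ST ST ShM_closed[OF T_Ob T_Ob End(2)]]] by simp
    then show ?thesis
      using rotate[OF rotate[OF rotate[OF rotate[OF t]]]] by (simp add: r_def)
  qed
  note to3 = triangleD[OF t3]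
  have r_inj: "y = \<zero>\<^bsub>Hom C T (Sh C Y)\<^esub>"
    if y: "y \<in> mor C T (Sh C Y)" and ry: "r \<star> y = \<zero>\<^bsub>Hom C T (Sh C (Sh C T))\<^esub>" for y
  proof -
    obtain x where "x \<in> mor C T (Sh C T)" "y = (\<ominus>\<^bsub>Hom C (Sh C T) (Sh C Y)\<^esub> (ShM C p)) \<star> x"
      using triangle_lift[OF t3 T_Ob y ry] .
    then show ?thesis using T_rigid comp_zero_right[OF T_Ob ST SY to3(5)] by simp
  qed

  obtain \<Phi> where
    \<Phi>: "\<And>\<psi>. \<psi> \<in> carrier (dual_space K (Hom C T T)) \<Longrightarrow> \<Phi> \<psi> \<in> mor C T (Sh C (Sh C T))" and
    \<Phi>_onto: "\<And>f. f \<in> mor C T (Sh C (Sh C T)) \<Longrightarrow> \<exists>\<psi> \<in> carrier (dual_space K (Hom C T T)). f = \<Phi> \<psi>" and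
    \<Phi>_inj: "inj_on \<Phi> (carrier (dual_space K (Hom C T T)))" and
    \<Phi>_zero: "\<Phi> (\<lambda>h\<in>mor C T T. \<zero>\<^bsub>K\<^esub>) = \<zero>\<^bsub>Hom C T (Sh C (Sh C T))\<^esub>" and
    \<Phi>_right: "\<And>\<psi> x. \<lbrakk>\<psi> \<in> carrier (dual_space K (Hom C T T)); x \<in> mor C T T\<rbrakk>
      \<Longrightarrow> \<Phi> \<psi> \<star> x = \<Phi> (\<lambda>h\<in>mor C T T. \<psi> (x \<star> h))" and
    \<Phi>_left: "\<And>\<psi> x. \<lbrakk>\<psi> \<in> carrier (dual_space K (Hom C T T)); x \<in> mor C T T\<rbrakk>
      \<Longrightarrow> ShM C (ShM C x) \<star> \<Phi> \<psi> = \<Phi> (\<lambda>h\<in>mor C T T. \<psi> (h \<star> x))"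
    by (rule duality) (rule that)
  let ?D = "carrier (dual_space K (Hom C T T))"
  have zeroD: "(\<lambda>h\<in>mor C T T. \<zero>\<^bsub>K\<^esub>) \<in> ?D" by (rule zero_form[OF Hom_module[OF T_Ob T_Ob]])

  have kill_\<gamma>: "y \<star> \<gamma> = \<zero>\<^bsub>Hom C T (Sh C Y)\<^esub>" if y: "y \<in> mor C T (Sh C Y)" for y
  proof (rule r_inj)
    show "y \<star> \<gamma> \<in> mor C T (Sh C Y)" using comp_closed[OF T_Ob T_Ob SY End(3) y] .
    have ry: "r \<star> y \<in> mor C T (Sh C (Sh C T))" using comp_closed[OF T_Ob SY SST y to3(6)] .
    then obtain \<psi> where \<psi>: "\<psi> \<in> ?D" "r \<star> y = \<Phi> \<psi>" using \<Phi>_onto by blast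
    \<comment> \<open>\<open>r \<star> y\<close> corresponds to a form \<open>\<psi>\<close> that vanishes on \<open>(End T) u\<close>, hence on \<open>\<gamma> (End T)\<close>\<close>
    have "ShM C (ShM C u) \<star> (r \<star> y) = (ShM C (ShM C u) \<star> r) \<star> y"
      by (rule comp_assoc[OF T_Ob SY SST _ y to3(6,7), symmetric]) (rule Sh_closed[OF ST])
    also have "\<dots> = \<zero>\<^bsub>Hom C T (Sh C (Sh C T))\<^esub>"
      unfolding triangle_comp_zero'(1)[OF t3] by (rule comp_zero_left[OF T_Ob SY SST y])
    finally have "\<Phi> (\<lambda>h\<in>mor C T T. \<psi> (h \<star> u)) = \<Phi> (\<lambda>h\<in>mor C T T. \<zero>\<^bsub>K\<^esub>)"
      using \<Phi>_left[OF \<psi>(1) End(2)] \<psi>(2) \<Phi>_zero by simp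
    moreover have "(\<lambda>h\<in>mor C T T. \<psi> (h \<star> u)) \<in> ?D"
      using dual_space_precomp[OF \<psi>(1) comp_linear_left[OF T_Ob T_Ob T_Ob End(2)] Hom_module[OF T_Ob T_Ob]] .
    ultimately have eq: "(\<lambda>h\<in>mor C T T. \<psi> (h \<star> u)) = (\<lambda>h\<in>mor C T T. \<zero>\<^bsub>K\<^esub>)"
      using inj_onD[OF \<Phi>_inj _ _ zeroD] by blast
    have u: "\<psi> (h \<star> u) = \<zero>\<^bsub>K\<^esub>" if "h \<in> mor C T T" for h
      using fun_cong[OF eq, of h] that by simp
    have "(\<lambda>h\<in>mor C T T. \<psi> (\<gamma> \<star> h)) = (\<lambda>h\<in>mor C T T. \<zero>\<^bsub>K\<^esub>)"
      by (rule restrict_ext) (use \<gamma>_u u in fastforce)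
    then have "(r \<star> y) \<star> \<gamma> = \<zero>\<^bsub>Hom C T (Sh C (Sh C T))\<^esub>"
      using \<Phi>_right[OF \<psi>(1) End(3)] \<psi>(2) \<Phi>_zero by simp
    then show "r \<star> (y \<star> \<gamma>) = \<zero>\<^bsub>Hom C T (Sh C (Sh C T))\<^esub>"
      using comp_assoc[OF T_Ob T_Ob SY SST End(3) y to3(6)] by simp
  qed

  obtain z where z: "z \<in> mor C T (Sh C Y)" "z \<star> e = z" "z \<noteq> \<zero>\<^bsub>Hom C T (Sh C Y)\<^esub>"
  proof -
    \<comment> \<open>since \<open>\<phi>\<close> vanishes on \<open>(End T) u\<close>, it lifts along \<open>r\<close>; multiplying the lift by \<open>e\<close> makes it fixed by \<open>e\<close>\<close>
    have "(\<lambda>h\<in>mor C T T. \<phi> (h \<star> u)) = (\<lambda>h\<in>mor C T T. \<zero>\<^bsub>K\<^esub>)"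
      by (rule restrict_ext) (simp add: form_u)
    then have "ShM C (ShM C u) \<star> \<Phi> \<phi> = \<zero>\<^bsub>Hom C T (Sh C (Sh C T))\<^esub>"
      using \<Phi>_left[OF form End(2)] \<Phi>_zero by simp
    then obtain z0 where z0: "z0 \<in> mor C T (Sh C Y)" "\<Phi> \<phi> = r \<star> z0"
      using triangle_lift[OF rotate[OF t3] T_Ob \<Phi>[OF form]] by blast
    have z: "z0 \<star> e \<in> mor C T (Sh C Y)" using comp_closed[OF T_Ob T_Ob SY End(1) z0(1)] .
    have "(z0 \<star> e) \<star> e = z0 \<star> e"
      using comp_assoc[OF T_Ob T_Ob T_Ob SY End(1) End(1) z0(1)] idem by simp
    moreover have "z0 \<star> e \<noteq> \<zero>\<^bsub>Hom C T (Sh C Y)\<^esub>"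
    proof
      assume "z0 \<star> e = \<zero>\<^bsub>Hom C T (Sh C Y)\<^esub>"
      then have "(r \<star> z0) \<star> e = \<zero>\<^bsub>Hom C T (Sh C (Sh C T))\<^esub>"
        using comp_assoc[OF T_Ob T_Ob SY SST End(1) z0(1) to3(6)]
          comp_zero_right[OF T_Ob SY SST to3(6)] by simp
      then have "\<Phi> (\<lambda>h\<in>mor C T T. \<phi> (e \<star> h)) = \<Phi> (\<lambda>h\<in>mor C T T. \<zero>\<^bsub>K\<^esub>)"
        using \<Phi>_right[OF form End(1)] z0(2) \<Phi>_zero by simp
      then have "(\<lambda>h\<in>mor C T T. \<phi> (e \<star> h)) = (\<lambda>h\<in>mor C T T. \<zero>\<^bsub>K\<^esub>)"
        by (rule inj_onD[OF \<Phi>_inj _ _ zeroD])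
          (rule dual_space_precomp[OF form comp_linear_right[OF T_Ob T_Ob T_Ob End(1)] Hom_module[OF T_Ob T_Ob]])
      then have "\<phi> (e \<star> h) = \<zero>\<^bsub>K\<^esub>" if "h \<in> mor C T T" for h
        using that by (auto dest: fun_cong[of _ _ h])
      then show False using form_e by blast
    qed
    ultimately show ?thesis using that z by blast
  qed

  have Y_e: "x \<star> e = \<zero>\<^bsub>Hom C T Y\<^esub>" if x: "x \<in> mor C T Y" for x
  proof -
    have "q \<star> x = \<zero>\<^bsub>Hom C T (Sh C T)\<^esub>"
      using comp_closed[OF T_Ob to(3) ST x to(7)] T_rigid by blast
    then obtain y where y: "y \<in> mor C T T" "x = p \<star> y"
      using triangle_lift[OF rotate[OF t] T_Ob x] by blast
    have ye: "y \<star> e \<in> mor C T T" using comp_closed[OF T_Ob T_Ob T_Ob End(1) y(1)] .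
    have "y \<star> e = u \<star> (y \<star> e)"
      using corner[OF y(1)] u_e comp_assoc[OF T_Ob T_Ob T_Ob T_Ob ye End(1) End(2)] by simp
    then have "x \<star> e = p \<star> (u \<star> (y \<star> e))"
      using y(2) comp_assoc[OF T_Ob T_Ob T_Ob to(3) End(1) y(1) to(6)] by simp
    also have "\<dots> = (p \<star> u) \<star> (y \<star> e)"
      by (rule comp_assoc[OF T_Ob T_Ob T_Ob to(3) ye End(2) to(6), symmetric])
    also have "\<dots> = \<zero>\<^bsub>Hom C T Y\<^esub>"
      unfolding triangle_comp_zero[OF t] by (rule comp_zero_left[OF T_Ob T_Ob to(3) ye])
    finally show ?thesis .
  qed

  \<comment> \<open>lift \<open>z\<close>, and then the vanishing of \<open>z \<star> \<gamma>\<close>, one step to the left in the approximation triangle\<close>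
  obtain w where w: "w \<in> mor C T S'" "z = c \<star> w"
  proof -
    have t2: "(S, S', Sh C Y, d, c, \<ominus>\<^bsub>Hom C (Sh C Y) (Sh C S)\<^esub> ShM C a) \<in> Tri C"
      using rotate[OF t'] .
    have "(\<ominus>\<^bsub>Hom C (Sh C Y) (Sh C S)\<^esub> ShM C a) \<star> z = \<zero>\<^bsub>Hom C T (Sh C S)\<^esub>"
      using comp_closed[OF T_Ob SY SS z(1) triangleD(7)[OF t2]] S by (simp add: T_like_def)
    then show ?thesis using triangle_lift[OF rotate[OF t2] T_Ob z(1)] that by blast
  qed
  obtain v where v: "v \<in> mor C T S" "w \<star> \<gamma> = d \<star> v"
  proof -
    have "c \<star> (w \<star> \<gamma>) = \<zero>\<^bsub>Hom C T (Sh C Y)\<^esub>"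
      using kill_\<gamma>[OF z(1)] w comp_assoc[OF T_Ob T_Ob to'(3) SY End(3) w(1) to'(7)] by simp
    then show ?thesis
      using triangle_lift[OF rotate[OF t'] T_Ob comp_closed[OF T_Ob T_Ob to'(3) End(3) w(1)]] that by blast
  qed
  have v\<gamma>: "v \<star> \<gamma> = \<zero>\<^bsub>Hom C T S\<^esub>"
  proof -
    have v\<gamma>: "v \<star> \<gamma> \<in> mor C T S" using comp_closed[OF T_Ob T_Ob SO End(3) v(1)] .
    have "d \<star> (v \<star> \<gamma>) = (w \<star> \<gamma>) \<star> \<gamma>"
      using v comp_assoc[OF T_Ob T_Ob SO to'(3) End(3) v(1) to'(6)] by simp
    also have "\<dots> = \<zero>\<^bsub>Hom C T S'\<^esub>"
      using comp_assoc[OF T_Ob T_Ob T_Ob to'(3) End(3) End(3) w(1)] \<gamma>_\<gamma>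
        comp_zero_right[OF T_Ob T_Ob to'(3) w(1)] by simp
    finally obtain x where x: "x \<in> mor C T Y" "v \<star> \<gamma> = a \<star> x"
      using triangle_lift[OF t' T_Ob v\<gamma>] by blast
    \<comment> \<open>\<open>v \<star> \<gamma>\<close> is fixed by \<open>e\<close> but comes from \<open>Hom(T, Y)\<close>, which \<open>e\<close> kills\<close>
    have "v \<star> \<gamma> = (v \<star> \<gamma>) \<star> e"
      using comp_assoc[OF T_Ob T_Ob T_Ob SO End(1) End(3) v(1)] \<gamma>_e by simp
    also have "\<dots> = a \<star> (x \<star> e)"
      using x comp_assoc[OF T_Ob T_Ob to(3) SO End(1) x(1) a] by simp
    also have "\<dots> = \<zero>\<^bsub>Hom C T S\<^esub>"
      using Y_e[OF x(1)] comp_zero_right[OF T_Ob to(3) SO a] by simp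
    finally show ?thesis .
  qed
  then obtain v' where v': "v' \<in> mor C T S" "v \<star> e = v' \<star> \<gamma>"
    using S v(1) by (auto simp: T_like_def)

  interpret H: abelian_group "Hom C T S'" using Hom_group to'(3) by blast
  interpret H2: abelian_group "Hom C T (Sh C Y)" using Hom_group SY by blast
  let ?n = "\<lambda>f. \<ominus>\<^bsub>Hom C T S'\<^esub> f"
  have dv': "d \<star> v' \<in> mor C T S'" using comp_closed[OF T_Ob SO to'(3) v'(1) to'(6)] .
  have ndv': "?n (d \<star> v') \<in> mor C T S'" using dv' by simp
  \<comment> \<open>correcting \<open>w\<close> by \<open>d \<star> v'\<close> makes it killed by \<open>\<gamma>\<close> without changing its image \<open>z\<close> under \<open>c\<close>\<close>
  define x where "x = w \<oplus>\<^bsub>Hom C T S'\<^esub> ?n (d \<star> v')"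
  have x: "x \<in> mor C T S'" unfolding x_def using w(1) ndv' by simp
  have "(d \<star> v') \<star> \<gamma> = w \<star> \<gamma>"
  proof -
    have "(d \<star> v') \<star> \<gamma> = d \<star> (v \<star> e)"
      using comp_assoc[OF T_Ob T_Ob SO to'(3) End(3) v'(1) to'(6)] v'(2) by simp
    also have "\<dots> = (w \<star> \<gamma>) \<star> e"
      using comp_assoc[OF T_Ob T_Ob SO to'(3) End(1) v(1) to'(6)] v(2) by simp
    also have "\<dots> = w \<star> \<gamma>"
      using comp_assoc[OF T_Ob T_Ob T_Ob to'(3) End(1) End(3) w(1)] \<gamma>_e by simp
    finally show ?thesis .
  qed
  then have "x \<star> \<gamma> = \<zero>\<^bsub>Hom C T S'\<^esub>"
    unfolding x_def comp_add_left[OF T_Ob T_Ob to'(3) End(3) w(1) ndv']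
      comp_neg_left[OF T_Ob T_Ob to'(3) End(3) dv']
    using comp_closed[OF T_Ob T_Ob to'(3) End(3) w(1)] by (simp add: H.r_neg)
  then obtain y where y: "y \<in> mor C T S'" "x \<star> e = y \<star> \<gamma>"
    using S' x by (auto simp: T_like_def)
  have "c \<star> x = z"
  proof -
    have "c \<star> (d \<star> v') = \<zero>\<^bsub>Hom C T (Sh C Y)\<^esub>"
      using comp_assoc[OF T_Ob SO to'(3) SY v'(1) to'(6,7)] triangle_comp_zero'(1)[OF t']
        comp_zero_left[OF T_Ob SO SY v'(1)] by simp
    then show ?thesis
      unfolding x_def comp_add_right[OF T_Ob to'(3) SY w(1) ndv' to'(7)]
        comp_neg_right[OF T_Ob to'(3) SY dv' to'(7)]
      using w(2) z(1) neg_eq_zero_iff[OF T_Ob SY zero_mor[OF T_Ob SY]] by simp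
  qed
  then have "z = (c \<star> x) \<star> e" using z(2) by simp
  also have "\<dots> = (c \<star> y) \<star> \<gamma>"
    using comp_assoc[OF T_Ob T_Ob to'(3) SY End(1) x to'(7)]
      comp_assoc[OF T_Ob T_Ob to'(3) SY End(3) y(1) to'(7)] y(2) by simp
  also have "\<dots> = \<zero>\<^bsub>Hom C T (Sh C Y)\<^esub>"
    by (rule kill_\<gamma>[OF comp_closed[OF T_Ob to'(3) SY y(1) to'(7)]])
  finally show False using z(3) by simp
qed

end

section \<open>Path algebras\<close>

lemma (in abelian_monoid) finsum_Sigma:
  assumes "finite I" "\<And>i. i \<in> I \<Longrightarrow> finite (J i)"
    and g: "\<And>i j. i \<in> I \<Longrightarrow> j \<in> J i \<Longrightarrow> g i j \<in> carrier G"
  shows "(\<Oplus>i\<in>I. \<Oplus>j\<in>J i. g i j) = (\<Oplus>s\<in>Sigma I J. g (fst s) (snd s))"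
proof -
  have "(\<Oplus>s\<in>Sigma I J. g (fst s) (snd s)) = (\<Oplus>s\<in>(\<Union>i\<in>I. Pair i ` J i). g (fst s) (snd s))"
    by (rule arg_cong[where f = "finsum G _"]) auto
  also have "\<dots> = (\<Oplus>i\<in>I. \<Oplus>s\<in>Pair i ` J i. g (fst s) (snd s))"
    using assms by (intro add.finprod_UN_disjoint) (auto simp: pairwise_def disjnt_def)
  also have "\<dots> = (\<Oplus>i\<in>I. \<Oplus>j\<in>J i. g i j)"
  proof (rule finsum_cong')
    fix i assume i: "i \<in> I"
    have "(\<Oplus>s\<in>Pair i ` J i. g (fst s) (snd s)) = (\<Oplus>j\<in>J i. g (fst (i, j)) (snd (i, j)))"
      by (rule finsum_reindex) (use i g in \<open>auto simp: inj_on_def\<close>)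
    then show "(\<Oplus>s\<in>Pair i ` J i. g (fst s) (snd s)) = (\<Oplus>j\<in>J i. g i j)" by simp
  qed (use g in \<open>auto intro!: finsum_closed\<close>)
  finally show ?thesis by simp
qed

locale quiver_algebra = cring K + wf_digraph G
  for K :: "('k, 'r) ring_scheme" (structure) and G :: "('v, 'e) pre_digraph"
begin

declare split_paired_All [simp del] split_paired_Ex [simp del]

abbreviation A where "A \<equiv> path_algebra K G"

lemma qpathsD: "x \<in> qpaths G \<Longrightarrow> awalk (fst x) (snd x) (qtarget G x)"
  by (auto simp: qpaths_def qtarget_def)

lemma qpathsI: "awalk u p v \<Longrightarrow> (u, p) \<in> qpaths G"
  by (auto simp: qpaths_def)

lemma qtarget_eq: "awalk u p v \<Longrightarrow> qtarget G (u, p) = v"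
  by (auto simp: qtarget_def)

lemma awalk_qcomp:
  assumes "x \<in> qpaths G" "y \<in> qpaths G" "qsource y = qtarget G x"
  shows "awalk (fst x) (snd x @ snd y) (qtarget G y)"
  using awalk_appendI qpathsD[OF assms(1)] qpathsD[OF assms(2)] assms(3)
  by (simp add: qsource_def)

lemma qcomp_qpaths [intro]:
  "\<lbrakk>x \<in> qpaths G; y \<in> qpaths G; qsource y = qtarget G x\<rbrakk> \<Longrightarrow> qcomp y x \<in> qpaths G"
  unfolding qcomp_def by (rule qpathsI, rule awalk_qcomp)

lemma qtarget_qcomp:
  "\<lbrakk>x \<in> qpaths G; y \<in> qpaths G; qsource y = qtarget G x\<rbrakk> \<Longrightarrow> qtarget G (qcomp y x) = qtarget G y"
  unfolding qcomp_def by (rule qtarget_eq, rule awalk_qcomp)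

lemma qsource_qcomp [simp]: "qsource (qcomp y x) = qsource x"
  by (simp add: qsource_def qcomp_def)

lemma qcomp_assoc: "qcomp (qcomp w y) x = qcomp w (qcomp y x)"
  by (simp add: qcomp_def)

lemma qsplitsD:
  assumes "(y, x) \<in> qsplits G z"
  shows "y \<in> qpaths G" "x \<in> qpaths G" "qsource y = qtarget G x" "qcomp y x = z"
  using assms by (auto simp: qsplits_def)

lemma qsplits_qpaths: "(y, x) \<in> qsplits G z \<Longrightarrow> z \<in> qpaths G"
  using qcomp_qpaths[of x y] qsplitsD[of y x z] by simp

text \<open>
  A factor of a path determines the complementary factor, so in a product with a single path at most one
  summand survives.
\<close>

lemma qsplits_unique:
  assumes "(y, x) \<in> qsplits G z" "(y', x') \<in> qsplits G z" "x = x' \<or> y = y'"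
  shows "x = x'" "y = y'"
proof -
  have *: "fst x = fst z" "snd z = snd x @ snd y" "fst y = qtarget G x"
    "fst x' = fst z" "snd z = snd x' @ snd y'" "fst y' = qtarget G x'"
    using qsplitsD[OF assms(1)] qsplitsD[OF assms(2)] by (auto simp: qcomp_def qsource_def)
  show eq: "x = x'" using * assms(3) by (auto simp: prod_eq_iff)
  show "y = y'" using * unfolding eq by (simp add: prod_eq_iff)
qed

lemma finite_qsplits: "finite (qsplits G z)"
proof (rule finite_subset)
  show "qsplits G z \<subseteq> (\<lambda>i. ((qtarget G (fst z, take i (snd z)), drop i (snd z)), (fst z, take i (snd z))))
      ` {..length (snd z)}"
  proof (clarify)
    fix v q u p assume "((v, q), (u, p)) \<in> qsplits G z"
    then show "((v, q), (u, p)) \<in> (\<lambda>i. ((qtarget G (fst z, take i (snd z)), drop i (snd z)), (fst z, take i (snd z))))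
      ` {..length (snd z)}"
      by (intro image_eqI[where x = "length p"]) (auto simp: qsplits_def qcomp_def qsource_def)
  qed
qed simp

lemma carrier_A: "f \<in> carrier A \<longleftrightarrow> (\<forall>z. f z \<in> carrier K) \<and> (\<forall>z. f z \<noteq> \<zero> \<longrightarrow> z \<in> qpaths G)
    \<and> finite {z. f z \<noteq> \<zero>}"
  by (auto simp: path_algebra_def)

lemma carrier_AD [simp]: "f \<in> carrier A \<Longrightarrow> f z \<in> carrier K"
  unfolding carrier_A by blast

lemma carrier_A_subset:
  assumes "f \<in> carrier A" "\<And>z. g z \<in> carrier K" "\<And>z. g z \<noteq> \<zero> \<Longrightarrow> f z \<noteq> \<zero>"
  shows "g \<in> carrier A"
proof -
  have "finite {z. g z \<noteq> \<zero>}"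
  proof (rule finite_subset)
    show "{z. g z \<noteq> \<zero>} \<subseteq> {z. f z \<noteq> \<zero>}" using assms(3) by blast
    show "finite {z. f z \<noteq> \<zero>}" using assms(1) unfolding carrier_A by blast
  qed
  then show ?thesis using assms unfolding carrier_A by blast
qed

lemma mult_A: "(f \<otimes>\<^bsub>A\<^esub> g) z = (\<Oplus>s \<in> qsplits G z. f (fst s) \<otimes> g (snd s))"
  by (simp add: path_algebra_def)

lemma add_A [simp]: "(f \<oplus>\<^bsub>A\<^esub> g) z = f z \<oplus> g z"
  and zero_A [simp]: "\<zero>\<^bsub>A\<^esub> z = \<zero>"
  and smult_A [simp]: "(c \<odot>\<^bsub>A\<^esub> f) z = c \<otimes> f z"
  by (simp_all add: path_algebra_def)

lemma mult_A_nonzero: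
  assumes "(f \<otimes>\<^bsub>A\<^esub> g) z \<noteq> \<zero>" "f \<in> carrier A" "g \<in> carrier A"
  shows "\<exists>y x. (y, x) \<in> qsplits G z \<and> f y \<noteq> \<zero> \<and> g x \<noteq> \<zero>"
proof (rule ccontr)
  assume "\<not> ?thesis"
  then have *: "f (fst s) = \<zero> \<or> g (snd s) = \<zero>" if "s \<in> qsplits G z" for s
    using that by (cases s) auto
  have "f (fst s) \<otimes> g (snd s) = \<zero>" if "s \<in> qsplits G z" for s
    using *[OF that] assms(2,3) by auto
  then have "(f \<otimes>\<^bsub>A\<^esub> g) z = \<zero>" unfolding mult_A by (intro add.finprod_one_eqI)
  then show False using assms by simp
qed

lemma mult_A_closed:
  assumes f: "f \<in> carrier A" and g: "g \<in> carrier A"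
  shows "f \<otimes>\<^bsub>A\<^esub> g \<in> carrier A"
  unfolding carrier_A
proof (intro conjI allI impI)
  fix z show "(f \<otimes>\<^bsub>A\<^esub> g) z \<in> carrier K" unfolding mult_A using f g by (intro finsum_closed) auto
next
  fix z assume nz: "(f \<otimes>\<^bsub>A\<^esub> g) z \<noteq> \<zero>"
  show "z \<in> qpaths G" using mult_A_nonzero[OF nz f g] qsplits_qpaths by blast
next
  have "{z. (f \<otimes>\<^bsub>A\<^esub> g) z \<noteq> \<zero>} \<subseteq> (\<lambda>(y, x). qcomp y x) ` ({z. f z \<noteq> \<zero>} \<times> {z. g z \<noteq> \<zero>})"
  proof
    fix z assume "z \<in> {z. (f \<otimes>\<^bsub>A\<^esub> g) z \<noteq> \<zero>}"
    then obtain y x where "(y, x) \<in> qsplits G z" "f y \<noteq> \<zero>" "g x \<noteq> \<zero>"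
      using mult_A_nonzero[OF _ f g] by blast
    then show "z \<in> (\<lambda>(y, x). qcomp y x) ` ({z. f z \<noteq> \<zero>} \<times> {z. g z \<noteq> \<zero>})"
      using qsplitsD(4)[of y x z] by (intro image_eqI[of _ _ "(y, x)"]) simp_all
  qed
  then show "finite {z. (f \<otimes>\<^bsub>A\<^esub> g) z \<noteq> \<zero>}"
    using f g by (rule_tac finite_subset) (auto simp: carrier_A)
qed

lemma add_A_closed: "f \<in> carrier A \<Longrightarrow> g \<in> carrier A \<Longrightarrow> f \<oplus>\<^bsub>A\<^esub> g \<in> carrier A"
proof -
  assume f: "f \<in> carrier A" and g: "g \<in> carrier A"
  have *: "f z \<noteq> \<zero> \<or> g z \<noteq> \<zero>" if "f z \<oplus> g z \<noteq> \<zero>" for z using that by auto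
  have "finite {z. f z \<oplus> g z \<noteq> \<zero>}"
  proof (rule finite_subset)
    show "{z. f z \<oplus> g z \<noteq> \<zero>} \<subseteq> {z. f z \<noteq> \<zero>} \<union> {z. g z \<noteq> \<zero>}" using * by blast
    show "finite ({z. f z \<noteq> \<zero>} \<union> {z. g z \<noteq> \<zero>})" using f g unfolding carrier_A by blast
  qed
  then show ?thesis
    using * f g a_closed unfolding carrier_A add_A by blast
qed

lemma smult_A_closed: "c \<in> carrier K \<Longrightarrow> f \<in> carrier A \<Longrightarrow> c \<odot>\<^bsub>A\<^esub> f \<in> carrier A"
  by (rule carrier_A_subset[of f]) auto

lemma abelian_group_A: "abelian_group A"
proof (rule abelian_groupI)
  show "\<zero>\<^bsub>A\<^esub> \<in> carrier A" by (simp add: carrier_A)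
  fix f assume f: "f \<in> carrier A"
  show "\<exists>g\<in>carrier A. g \<oplus>\<^bsub>A\<^esub> f = \<zero>\<^bsub>A\<^esub>"
  proof
    show "(\<lambda>z. \<ominus> f z) \<in> carrier A"
      by (rule carrier_A_subset[OF f]) (use f in auto)
    show "(\<lambda>z. \<ominus> f z) \<oplus>\<^bsub>A\<^esub> f = \<zero>\<^bsub>A\<^esub>"
      using f by (auto simp: l_neg)
  qed
next
  fix f g assume "f \<in> carrier A" "g \<in> carrier A"
  then show "f \<oplus>\<^bsub>A\<^esub> g = g \<oplus>\<^bsub>A\<^esub> f" by (intro ext) (simp add: a_comm)
qed (auto simp: add_A_closed a_assoc intro!: ext)

text \<open>
  Both iterated products are sums over the set of factorisations of \<open>z\<close> into three paths.
\<close>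

lemma mult_A_assoc:
  assumes f: "f \<in> carrier A" and g: "g \<in> carrier A" and h: "h \<in> carrier A"
  shows "(f \<otimes>\<^bsub>A\<^esub> g) \<otimes>\<^bsub>A\<^esub> h = f \<otimes>\<^bsub>A\<^esub> (g \<otimes>\<^bsub>A\<^esub> h)"
proof
  fix z
  define T where "T = {(a, b, c). a \<in> qpaths G \<and> b \<in> qpaths G \<and> c \<in> qpaths G \<and>
    qsource a = qtarget G b \<and> qsource b = qtarget G c \<and> qcomp a (qcomp b c) = z}"
  have left: "(SIGMA s:qsplits G z. qsplits G (fst s)) = (\<lambda>(a, b, c). ((qcomp a b, c), (a, b))) ` T"
  proof (intro equalityI subsetI)
    fix s assume "s \<in> (SIGMA s:qsplits G z. qsplits G (fst s))"
    then obtain y c a b where s: "s = ((y, c), (a, b))" "(y, c) \<in> qsplits G z" "(a, b) \<in> qsplits G y"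
      by (metis SigmaE fst_conv surj_pair)
    note 1 = qsplitsD[OF s(2)] and 2 = qsplitsD[OF s(3)]
    have "(a, b, c) \<in> T" using 1 2 qsource_qcomp[of a b] by (simp add: T_def qcomp_assoc[symmetric])
    then show "s \<in> (\<lambda>(a, b, c). ((qcomp a b, c), (a, b))) ` T"
      using s(1) 2(4) by (intro image_eqI[of _ _ "(a, b, c)"]) simp_all
  next
    fix s assume "s \<in> (\<lambda>(a, b, c). ((qcomp a b, c), (a, b))) ` T"
    then show "s \<in> (SIGMA s:qsplits G z. qsplits G (fst s))"
      by (auto simp: T_def qsplits_def qcomp_assoc)
  qed
  have right: "(SIGMA s:qsplits G z. qsplits G (snd s)) = (\<lambda>(a, b, c). ((a, qcomp b c), (b, c))) ` T"
  proof (intro equalityI subsetI)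
    fix s assume "s \<in> (SIGMA s:qsplits G z. qsplits G (snd s))"
    then obtain a x b c where s: "s = ((a, x), (b, c))" "(a, x) \<in> qsplits G z" "(b, c) \<in> qsplits G x"
      by (metis SigmaE snd_conv surj_pair)
    note 1 = qsplitsD[OF s(2)] and 2 = qsplitsD[OF s(3)]
    have "(a, b, c) \<in> T" using 1 2 qtarget_qcomp[OF 2(2,1,3)] by (simp add: T_def)
    then show "s \<in> (\<lambda>(a, b, c). ((a, qcomp b c), (b, c))) ` T"
      using s(1) 2(4) by (intro image_eqI[of _ _ "(a, b, c)"]) simp_all
  next
    fix s assume "s \<in> (\<lambda>(a, b, c). ((a, qcomp b c), (b, c))) ` T"
    then show "s \<in> (SIGMA s:qsplits G z. qsplits G (snd s))"
      by (auto simp: T_def qsplits_def qtarget_qcomp)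
  qed
  let ?F = "\<lambda>(a, b, c). f a \<otimes> g b \<otimes> h c"
  have "((f \<otimes>\<^bsub>A\<^esub> g) \<otimes>\<^bsub>A\<^esub> h) z =
      (\<Oplus>s\<in>qsplits G z. \<Oplus>t\<in>qsplits G (fst s). f (fst t) \<otimes> g (snd t) \<otimes> h (snd s))"
    unfolding mult_A[of "f \<otimes>\<^bsub>A\<^esub> g"]
  proof (rule finsum_cong')
    fix s assume "s \<in> qsplits G z"
    show "(f \<otimes>\<^bsub>A\<^esub> g) (fst s) \<otimes> h (snd s) =
        (\<Oplus>t\<in>qsplits G (fst s). f (fst t) \<otimes> g (snd t) \<otimes> h (snd s))"
      unfolding mult_A using f g h by (intro finsum_ldistr) (auto simp: finite_qsplits)
  qed (use f g h in \<open>auto intro!: finsum_closed\<close>)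
  also have "\<dots> = (\<Oplus>s\<in>(SIGMA s:qsplits G z. qsplits G (fst s)).
      f (fst (snd s)) \<otimes> g (snd (snd s)) \<otimes> h (snd (fst s)))"
    using f g h by (intro finsum_Sigma) (auto simp: finite_qsplits)
  also have "(SIGMA s:qsplits G z. qsplits G (fst s)) = (\<lambda>(a, b, c). ((qcomp a b, c), (a, b))) ` T"
    by (rule left)
  also have "(\<Oplus>s\<in>\<dots>. f (fst (snd s)) \<otimes> g (snd (snd s)) \<otimes> h (snd (fst s))) = (\<Oplus>t\<in>T. ?F t)"
  proof (subst finsum_reindex)
    show "inj_on (\<lambda>(a, b, c). ((qcomp a b, c), (a, b))) T" by (auto simp: inj_on_def)
  qed (use f g h in \<open>auto intro!: finsum_cong'\<close>)
  also have "\<dots> = (\<Oplus>s\<in>(\<lambda>(a, b, c). ((a, qcomp b c), (b, c))) ` T.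
      f (fst (fst s)) \<otimes> (g (fst (snd s)) \<otimes> h (snd (snd s))))"
  proof (subst finsum_reindex)
    show "inj_on (\<lambda>(a, b, c). ((a, qcomp b c), (b, c))) T" by (auto simp: inj_on_def)
  qed (use f g h in \<open>auto intro!: finsum_cong' simp: m_assoc\<close>)
  also have "(\<lambda>(a, b, c). ((a, qcomp b c), (b, c))) ` T = (SIGMA s:qsplits G z. qsplits G (snd s))"
    by (rule right[symmetric])
  also have "(\<Oplus>s\<in>(SIGMA s:qsplits G z. qsplits G (snd s)).
      f (fst (fst s)) \<otimes> (g (fst (snd s)) \<otimes> h (snd (snd s)))) =
      (\<Oplus>s\<in>qsplits G z. \<Oplus>t\<in>qsplits G (snd s). f (fst s) \<otimes> (g (fst t) \<otimes> h (snd t)))"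
    using f g h by (intro finsum_Sigma[symmetric]) (auto simp: finite_qsplits)
  also have "\<dots> = (f \<otimes>\<^bsub>A\<^esub> (g \<otimes>\<^bsub>A\<^esub> h)) z"
    unfolding mult_A[of f]
  proof (rule finsum_cong')
    fix s assume "s \<in> qsplits G z"
    show "(\<Oplus>t\<in>qsplits G (snd s). f (fst s) \<otimes> (g (fst t) \<otimes> h (snd t))) =
        f (fst s) \<otimes> (g \<otimes>\<^bsub>A\<^esub> h) (snd s)"
      unfolding mult_A using f g h by (intro finsum_rdistr[symmetric]) (auto simp: finite_qsplits)
  qed (use f g h mult_A_closed in auto)
  finally show "((f \<otimes>\<^bsub>A\<^esub> g) \<otimes>\<^bsub>A\<^esub> h) z = (f \<otimes>\<^bsub>A\<^esub> (g \<otimes>\<^bsub>A\<^esub> h)) z" .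
qed

lemma mult_path_elt_right:
  assumes f: "f \<in> carrier A" and s: "(y, w) \<in> qsplits G z"
  shows "(f \<otimes>\<^bsub>A\<^esub> path_elt K w) z = f y"
proof -
  have "(f \<otimes>\<^bsub>A\<^esub> path_elt K w) z = (\<Oplus>t\<in>qsplits G z. if (y, w) = t then f (fst t) else \<zero>)"
    unfolding mult_A
  proof (rule finsum_cong')
    fix t assume "t \<in> qsplits G z"
    then have t': "(fst t, snd t) \<in> qsplits G z" by simp
    show "f (fst t) \<otimes> path_elt K w (snd t) = (if (y, w) = t then f (fst t) else \<zero>)"
    proof (cases "snd t = w")
      case True
      then have "y = fst t" using qsplits_unique(2)[OF s t'] by simp
      with True show ?thesis using f by (auto simp: path_elt_def)
    next
      case False
      then have "(y, w) \<noteq> t" by auto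
      with False show ?thesis using f by (simp add: path_elt_def)
    qed
  qed (use f in auto)
  also have "\<dots> = f y"
    using add.finprod_singleton[OF s finite_qsplits, of "\<lambda>t. f (fst t)"] f by simp
  finally show ?thesis .
qed

lemma mult_path_elt_left:
  assumes g: "g \<in> carrier A" and s: "(w, x) \<in> qsplits G z"
  shows "(path_elt K w \<otimes>\<^bsub>A\<^esub> g) z = g x"
proof -
  have "(path_elt K w \<otimes>\<^bsub>A\<^esub> g) z = (\<Oplus>t\<in>qsplits G z. if (w, x) = t then g (snd t) else \<zero>)"
    unfolding mult_A
  proof (rule finsum_cong')
    fix t assume "t \<in> qsplits G z"
    then have t': "(fst t, snd t) \<in> qsplits G z" by simp
    show "path_elt K w (fst t) \<otimes> g (snd t) = (if (w, x) = t then g (snd t) else \<zero>)"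
    proof (cases "fst t = w")
      case True
      then have "x = snd t" using qsplits_unique(1)[OF s t'] by simp
      with True show ?thesis using g by (auto simp: path_elt_def)
    next
      case False
      then have "(w, x) \<noteq> t" by auto
      with False show ?thesis using g by (simp add: path_elt_def)
    qed
  qed (use g in auto)
  also have "\<dots> = g x"
    using add.finprod_singleton[OF s finite_qsplits, of "\<lambda>t. g (snd t)"] g by simp
  finally show ?thesis .
qed

lemma path_elt_closed [simp]: "w \<in> qpaths G \<Longrightarrow> path_elt K w \<in> carrier A"
  by (auto simp: carrier_A path_elt_def intro: finite_subset[of _ "{w}"])

lemma mult_path_elt_right_zero:
  assumes f: "f \<in> carrier A" and s: "\<And>y. (y, w) \<notin> qsplits G z"
  shows "(f \<otimes>\<^bsub>A\<^esub> path_elt K w) z = \<zero>"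
  unfolding mult_A using f s
  by (intro add.finprod_one_eqI) (force simp: path_elt_def)

lemma mult_path_elt_left_zero:
  assumes g: "g \<in> carrier A" and s: "\<And>x. (w, x) \<notin> qsplits G z"
  shows "(path_elt K w \<otimes>\<^bsub>A\<^esub> g) z = \<zero>"
  unfolding mult_A using g s
  by (intro add.finprod_one_eqI) (force simp: path_elt_def)

lemma outside_qpaths: "f \<in> carrier A \<Longrightarrow> z \<notin> qpaths G \<Longrightarrow> f z = \<zero>"
  by (auto simp: carrier_A)

lemma mult_vertex_right:
  assumes f: "f \<in> carrier A" and v: "v \<in> verts G"
  shows "(f \<otimes>\<^bsub>A\<^esub> path_elt K (v, [])) z = (if fst z = v then f z else \<zero>)"
proof (cases "z \<in> qpaths G \<and> fst z = v")
  case True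
  then have "(z, (v, [])) \<in> qsplits G z"
    using v by (auto simp: qsplits_def qsource_def qcomp_def qtarget_def qpaths_def awalk_Nil_iff)
  then show ?thesis using mult_path_elt_right[OF f] True by simp
next
  case False
  then have ns: "(y, (v, [])) \<notin> qsplits G z" for y
    using qsplits_qpaths[of y "(v, [])" z] qsplitsD(4)[of y "(v, [])" z] by (auto simp: qcomp_def)
  then show ?thesis using mult_path_elt_right_zero[OF f ns] outside_qpaths[OF f, of z] False by auto
qed

lemma mult_vertex_left:
  assumes g: "g \<in> carrier A" and v: "v \<in> verts G"
  shows "(path_elt K (v, []) \<otimes>\<^bsub>A\<^esub> g) z = (if qtarget G z = v then g z else \<zero>)"
proof (cases "z \<in> qpaths G \<and> qtarget G z = v")
  case True
  then have "((v, []), z) \<in> qsplits G z"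
    using v by (auto simp: qsplits_def qsource_def qcomp_def qpaths_def awalk_Nil_iff)
  then show ?thesis using mult_path_elt_left[OF g] True by simp
next
  case False
  then have ns: "((v, []), x) \<notin> qsplits G z" for x
    by (auto simp: qsplits_def qcomp_def qsource_def)
  then show ?thesis using mult_path_elt_left_zero[OF g ns] outside_qpaths[OF g, of z] False by auto
qed

lemma mult_arrow_right:
  assumes f: "f \<in> carrier A" and a: "a \<in> arcs G"
  shows "(f \<otimes>\<^bsub>A\<^esub> arrow_elt K G a) (v, a' # p) =
    (if a' = a \<and> v = tail G a then f (head G a, p) else \<zero>)"
    and "(f \<otimes>\<^bsub>A\<^esub> arrow_elt K G a) (v, []) = \<zero>"
proof -
  note aw = arc_implies_awalk[OF a]
  show "(f \<otimes>\<^bsub>A\<^esub> arrow_elt K G a) (v, a' # p) =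
    (if a' = a \<and> v = tail G a then f (head G a, p) else \<zero>)"
  proof (cases "(head G a, p) \<in> qpaths G \<and> a' = a \<and> v = tail G a")
    case True
    then have "((head G a, p), (tail G a, [a])) \<in> qsplits G (v, a' # p)"
      using aw by (auto simp: qsplits_def qsource_def qcomp_def qtarget_eq intro: qpathsI)
    then show ?thesis using mult_path_elt_right[OF f] True by (simp add: arrow_elt_def)
  next
    case False
    have ns: "(y, (tail G a, [a])) \<notin> qsplits G (v, a' # p)" for y
    proof
      assume *: "(y, (tail G a, [a])) \<in> qsplits G (v, a' # p)"
      then have "y = (head G a, p)" "a' = a" "v = tail G a"
        using qtarget_eq[OF aw] by (cases y; auto simp: qsplits_def qsource_def qcomp_def)+
      then show False using False qsplitsD(1)[OF *] by simp
    qed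
    then show ?thesis using mult_path_elt_right_zero[OF f ns] outside_qpaths[OF f, of "(head G a, p)"] False
      by (auto simp: arrow_elt_def)
  qed
  have ns: "(y, (tail G a, [a])) \<notin> qsplits G (v, [])" for y by (auto simp: qsplits_def qcomp_def)
  then show "(f \<otimes>\<^bsub>A\<^esub> arrow_elt K G a) (v, []) = \<zero>"
    using mult_path_elt_right_zero[OF f ns] by (simp add: arrow_elt_def)
qed

lemma mult_arrow_left:
  assumes g: "g \<in> carrier A" and a: "a \<in> arcs G"
  shows "(arrow_elt K G a \<otimes>\<^bsub>A\<^esub> g) (v, p @ [a']) =
    (if a' = a \<and> qtarget G (v, p) = tail G a then g (v, p) else \<zero>)"
    and "(arrow_elt K G a \<otimes>\<^bsub>A\<^esub> g) (v, []) = \<zero>"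
proof -
  note aw = arc_implies_awalk[OF a]
  show "(arrow_elt K G a \<otimes>\<^bsub>A\<^esub> g) (v, p @ [a']) =
    (if a' = a \<and> qtarget G (v, p) = tail G a then g (v, p) else \<zero>)"
  proof (cases "(v, p) \<in> qpaths G \<and> a' = a \<and> qtarget G (v, p) = tail G a")
    case True
    then have "((tail G a, [a]), (v, p)) \<in> qsplits G (v, p @ [a'])"
      using aw by (auto simp: qsplits_def qsource_def qcomp_def intro: qpathsI)
    then show ?thesis using mult_path_elt_left[OF g] True by (simp add: arrow_elt_def)
  next
    case False
    have ns: "((tail G a, [a]), x) \<notin> qsplits G (v, p @ [a'])" for x
    proof
      assume *: "((tail G a, [a]), x) \<in> qsplits G (v, p @ [a'])"
      then have "x = (v, p)" "a' = a" "qtarget G x = tail G a"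
        by (cases x; auto simp: qsplits_def qsource_def qcomp_def)+
      then show False using False qsplitsD(2)[OF *] by simp
    qed
    then show ?thesis using mult_path_elt_left_zero[OF g ns] outside_qpaths[OF g, of "(v, p)"] False
      by (auto simp: arrow_elt_def)
  qed
  have ns: "((tail G a, [a]), x) \<notin> qsplits G (v, [])" for x by (auto simp: qsplits_def qcomp_def)
  then show "(arrow_elt K G a \<otimes>\<^bsub>A\<^esub> g) (v, []) = \<zero>"
    using mult_path_elt_left_zero[OF g ns] by (simp add: arrow_elt_def)
qed

lemma neg_A:
  assumes f: "f \<in> carrier A"
  shows "(\<ominus>\<^bsub>A\<^esub> f) z = \<ominus> f z"
proof -
  interpret PA: abelian_group A by (rule abelian_group_A)
  have "(\<ominus>\<^bsub>A\<^esub> f) z \<oplus> f z = \<zero>"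
    using PA.l_neg[OF f] add_A[of "\<ominus>\<^bsub>A\<^esub> f" f z] by simp
  then show ?thesis
    using f PA.a_inv_closed[OF f] by (simp add: minus_equality)
qed

lemma one_A: "\<one>\<^bsub>A\<^esub> z = (if z \<in> qpaths G \<and> snd z = [] then \<one> else \<zero>)"
  by (simp add: path_algebra_def)

lemma one_A_closed:
  assumes "finite (verts G)"
  shows "\<one>\<^bsub>A\<^esub> \<in> carrier A"
proof -
  have "{z. \<one>\<^bsub>A\<^esub> z \<noteq> \<zero>} \<subseteq> verts G \<times> {[]}"
    by (auto simp: one_A qpaths_def awalk_Nil_iff split: if_splits)
  then have "finite {z. \<one>\<^bsub>A\<^esub> z \<noteq> \<zero>}" using assms finite_subset by blast
  then show ?thesis unfolding carrier_A by (simp add: one_A)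
qed

lemma one_mult_A:
  assumes f: "f \<in> carrier A"
  shows "\<one>\<^bsub>A\<^esub> \<otimes>\<^bsub>A\<^esub> f = f"
proof
  fix z
  show "(\<one>\<^bsub>A\<^esub> \<otimes>\<^bsub>A\<^esub> f) z = f z"
  proof (cases "z \<in> qpaths G")
    case True
    have v: "qtarget G z \<in> verts G" using qpathsD[OF True] by auto
    have "(\<one>\<^bsub>A\<^esub> \<otimes>\<^bsub>A\<^esub> f) z = (path_elt K (qtarget G z, []) \<otimes>\<^bsub>A\<^esub> f) z"
      unfolding mult_A
    proof (rule finsum_cong')
      fix s assume "s \<in> qsplits G z"
      then have s: "(fst s, snd s) \<in> qsplits G z" by simp
      have "snd s = z" if "snd (fst s) = []"
        using qsplitsD(4)[OF s] that by (auto simp: qcomp_def prod_eq_iff)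
      then have "snd (fst s) = [] \<longleftrightarrow> fst s = (qtarget G z, [])"
        using qsplitsD(3)[OF s] by (cases "fst s") (auto simp: qsource_def)
      then have "\<one>\<^bsub>A\<^esub> (fst s) = path_elt K (qtarget G z, []) (fst s)"
        using qsplitsD(1)[OF s] by (auto simp: one_A path_elt_def)
      then show "\<one>\<^bsub>A\<^esub> (fst s) \<otimes> f (snd s) = path_elt K (qtarget G z, []) (fst s) \<otimes> f (snd s)" by simp
    qed (use f in \<open>auto simp: path_elt_def\<close>)
    then show ?thesis using mult_vertex_left[OF f v] by simp
  next
    case False
    then have "s \<notin> qsplits G z" for s using qsplits_qpaths[of "fst s" "snd s" z] by auto
    then have "qsplits G z = {}" by blast
    then show ?thesis unfolding mult_A using outside_qpaths[OF f False] by simp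
  qed
qed

lemma mult_one_A:
  assumes f: "f \<in> carrier A"
  shows "f \<otimes>\<^bsub>A\<^esub> \<one>\<^bsub>A\<^esub> = f"
proof
  fix z
  show "(f \<otimes>\<^bsub>A\<^esub> \<one>\<^bsub>A\<^esub>) z = f z"
  proof (cases "z \<in> qpaths G")
    case True
    have v: "fst z \<in> verts G" using qpathsD[OF True] by auto
    have "(f \<otimes>\<^bsub>A\<^esub> \<one>\<^bsub>A\<^esub>) z = (f \<otimes>\<^bsub>A\<^esub> path_elt K (fst z, [])) z"
      unfolding mult_A
    proof (rule finsum_cong')
      fix s assume "s \<in> qsplits G z"
      then have s: "(fst s, snd s) \<in> qsplits G z" by simp
      have "snd (snd s) = [] \<longleftrightarrow> snd s = (fst z, [])"
        using qsplitsD(3,4)[OF s] by (auto simp: qcomp_def qsource_def prod_eq_iff)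
      then have "\<one>\<^bsub>A\<^esub> (snd s) = path_elt K (fst z, []) (snd s)"
        using qsplitsD(2)[OF s] by (auto simp: one_A path_elt_def)
      then show "f (fst s) \<otimes> \<one>\<^bsub>A\<^esub> (snd s) = f (fst s) \<otimes> path_elt K (fst z, []) (snd s)" by simp
    qed (use f in \<open>auto simp: path_elt_def\<close>)
    then show ?thesis using mult_vertex_right[OF f v] by simp
  next
    case False
    then have "s \<notin> qsplits G z" for s using qsplits_qpaths[of "fst s" "snd s" z] by auto
    then have "qsplits G z = {}" by blast
    then show ?thesis unfolding mult_A using outside_qpaths[OF f False] by simp
  qed
qed

lemma smult_mult_A:
  assumes "c \<in> carrier K" "f \<in> carrier A" "g \<in> carrier A"
  shows "(c \<odot>\<^bsub>A\<^esub> f) \<otimes>\<^bsub>A\<^esub> g = c \<odot>\<^bsub>A\<^esub> (f \<otimes>\<^bsub>A\<^esub> g)"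
proof
  fix z
  have "((c \<odot>\<^bsub>A\<^esub> f) \<otimes>\<^bsub>A\<^esub> g) z = (\<Oplus>s\<in>qsplits G z. c \<otimes> (f (fst s) \<otimes> g (snd s)))"
    unfolding mult_A by (rule finsum_cong') (use assms in \<open>auto simp: m_assoc\<close>)
  also have "\<dots> = (c \<odot>\<^bsub>A\<^esub> (f \<otimes>\<^bsub>A\<^esub> g)) z"
    unfolding smult_A mult_A by (rule finsum_rdistr[symmetric]) (use assms in \<open>auto simp: finite_qsplits\<close>)
  finally show "((c \<odot>\<^bsub>A\<^esub> f) \<otimes>\<^bsub>A\<^esub> g) z = (c \<odot>\<^bsub>A\<^esub> (f \<otimes>\<^bsub>A\<^esub> g)) z" .
qed

lemma ring_A:
  assumes "finite (verts G)"
  shows "ring A"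
proof (rule ringI)
  show "abelian_group A" by (rule abelian_group_A)
  show "Group.monoid A"
    by (rule monoidI)
      (auto simp: mult_A_closed one_A_closed[OF assms] mult_A_assoc one_mult_A mult_one_A)
next
  fix f g h assume fgh: "f \<in> carrier A" "g \<in> carrier A" "h \<in> carrier A"
  show "(f \<oplus>\<^bsub>A\<^esub> g) \<otimes>\<^bsub>A\<^esub> h = f \<otimes>\<^bsub>A\<^esub> h \<oplus>\<^bsub>A\<^esub> g \<otimes>\<^bsub>A\<^esub> h"
  proof
    fix z
    have "((f \<oplus>\<^bsub>A\<^esub> g) \<otimes>\<^bsub>A\<^esub> h) z =
        (\<Oplus>s\<in>qsplits G z. f (fst s) \<otimes> h (snd s) \<oplus> g (fst s) \<otimes> h (snd s))"
      unfolding mult_A by (rule finsum_cong') (use fgh in \<open>auto simp: l_distr\<close>)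
    also have "\<dots> = (f \<otimes>\<^bsub>A\<^esub> h \<oplus>\<^bsub>A\<^esub> g \<otimes>\<^bsub>A\<^esub> h) z"
      unfolding add_A mult_A by (rule finsum_addf) (use fgh in auto)
    finally show "((f \<oplus>\<^bsub>A\<^esub> g) \<otimes>\<^bsub>A\<^esub> h) z = (f \<otimes>\<^bsub>A\<^esub> h \<oplus>\<^bsub>A\<^esub> g \<otimes>\<^bsub>A\<^esub> h) z" .
  qed
  show "h \<otimes>\<^bsub>A\<^esub> (f \<oplus>\<^bsub>A\<^esub> g) = h \<otimes>\<^bsub>A\<^esub> f \<oplus>\<^bsub>A\<^esub> h \<otimes>\<^bsub>A\<^esub> g"
  proof
    fix z
    have "(h \<otimes>\<^bsub>A\<^esub> (f \<oplus>\<^bsub>A\<^esub> g)) z =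
        (\<Oplus>s\<in>qsplits G z. h (fst s) \<otimes> f (snd s) \<oplus> h (fst s) \<otimes> g (snd s))"
      unfolding mult_A by (rule finsum_cong') (use fgh in \<open>auto simp: r_distr\<close>)
    also have "\<dots> = (h \<otimes>\<^bsub>A\<^esub> f \<oplus>\<^bsub>A\<^esub> h \<otimes>\<^bsub>A\<^esub> g) z"
      unfolding add_A mult_A by (rule finsum_addf) (use fgh in auto)
    finally show "(h \<otimes>\<^bsub>A\<^esub> (f \<oplus>\<^bsub>A\<^esub> g)) z = (h \<otimes>\<^bsub>A\<^esub> f \<oplus>\<^bsub>A\<^esub> h \<otimes>\<^bsub>A\<^esub> g) z" .
  qed
qed

text \<open>
  The \<open>(n + 1)\<close>-st power of the arrow ideal.
\<close>

definition long_ideal :: "nat \<Rightarrow> ('v \<times> 'e list \<Rightarrow> 'k) set" where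
  "long_ideal n = {f \<in> carrier A. \<forall>z. length (snd z) \<le> n \<longrightarrow> f z = \<zero>}"

lemma ideal_long_ideal:
  assumes "finite (verts G)"
  shows "ideal (long_ideal n) A"
proof -
  interpret PA: ring A using assms by (rule ring_A)
  have mult: "(f \<otimes>\<^bsub>A\<^esub> g) z = \<zero>"
    if fg: "f \<in> carrier A" "g \<in> carrier A" "f \<in> long_ideal n \<or> g \<in> long_ideal n" and z: "length (snd z) \<le> n" for f g z
  proof (rule ccontr)
    assume "(f \<otimes>\<^bsub>A\<^esub> g) z \<noteq> \<zero>"
    then obtain y x where s: "(y, x) \<in> qsplits G z" "f y \<noteq> \<zero>" "g x \<noteq> \<zero>"
      using mult_A_nonzero[OF _ fg(1,2)] by blast
    then have "length (snd y) \<le> n" "length (snd x) \<le> n"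
      using qsplitsD(4)[OF s(1)] z by (auto simp: qcomp_def)
    then show False using fg(3) s by (auto simp: long_ideal_def)
  qed
  show ?thesis
  proof (rule idealI)
    show "ring A" by (rule PA.ring_axioms)
    show "subgroup (long_ideal n) (add_monoid A)"
    proof
      fix f assume "f \<in> long_ideal n"
      then have "\<ominus>\<^bsub>A\<^esub> f \<in> long_ideal n" by (simp add: long_ideal_def neg_A)
      then show "inv\<^bsub>add_monoid A\<^esub> f \<in> long_ideal n" by (simp add: a_inv_def)
    qed (auto simp: long_ideal_def add_A_closed)
  next
    fix f g assume f: "f \<in> long_ideal n" and g: "g \<in> carrier A"
    then have f': "f \<in> carrier A" by (simp add: long_ideal_def)
    show "g \<otimes>\<^bsub>A\<^esub> f \<in> long_ideal n" "f \<otimes>\<^bsub>A\<^esub> g \<in> long_ideal n"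
      using mult[OF g f'] mult[OF f' g] f f' g mult_A_closed by (simp_all add: long_ideal_def)
  qed
qed

text \<open>
  Deleting the arrow \<open>a\<close> from the start of all paths that begin with it; \<open>strip_last_closed\<close> does the
  same at the end.  These produce the quotients of an element by an arrow.
\<close>

lemma strip_first_closed:
  assumes x: "x \<in> carrier A" and a: "a \<in> arcs G"
  shows "(\<lambda>z. if fst z = head G a then x (tail G a, a # snd z) else \<zero>) \<in> carrier A" (is "?y \<in> _")
  unfolding carrier_A
proof (intro conjI allI impI)
  fix z show "?y z \<in> carrier K" using x by simp
next
  fix z assume "?y z \<noteq> \<zero>"
  then have "fst z = head G a" "x (tail G a, a # snd z) \<noteq> \<zero>" by (auto split: if_splits)
  then have "(tail G a, a # snd z) \<in> qpaths G" using outside_qpaths[OF x, of "(tail G a, a # snd z)"] by blast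
  with \<open>fst z = head G a\<close> show "z \<in> qpaths G"
    by (cases z) (auto simp: qpaths_def awalk_Cons_iff)
next
  have "{z. ?y z \<noteq> \<zero>} \<subseteq> (\<lambda>z. (head G a, tl (snd z))) ` {z. x z \<noteq> \<zero>}"
  proof
    fix z assume "z \<in> {z. ?y z \<noteq> \<zero>}"
    then have "fst z = head G a" "x (tail G a, a # snd z) \<noteq> \<zero>" by (auto split: if_splits)
    then show "z \<in> (\<lambda>z. (head G a, tl (snd z))) ` {z. x z \<noteq> \<zero>}"
      by (intro image_eqI[of _ _ "(tail G a, a # snd z)"]) (auto simp: prod_eq_iff)
  qed
  moreover have "finite {z. x z \<noteq> \<zero>}" using x unfolding carrier_A by blast
  ultimately show "finite {z. ?y z \<noteq> \<zero>}" by (meson finite_imageI finite_subset)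
qed

lemma qtarget_snoc [simp]: "qtarget G (v, p @ [a]) = head G a"
  by (simp add: qtarget_def awalk_verts_conv)

lemma qtarget_Nil [simp]: "qtarget G (v, []) = v"
  by (simp add: qtarget_def)

lemma strip_last_closed:
  assumes x: "x \<in> carrier A" and a: "a \<in> arcs G"
  shows "(\<lambda>z. if qtarget G z = tail G a then x (fst z, snd z @ [a]) else \<zero>) \<in> carrier A" (is "?y \<in> _")
  unfolding carrier_A
proof (intro conjI allI impI)
  fix z show "?y z \<in> carrier K" using x by simp
next
  fix z assume "?y z \<noteq> \<zero>"
  then have "x (fst z, snd z @ [a]) \<noteq> \<zero>" by (auto split: if_splits)
  then have "(fst z, snd z @ [a]) \<in> qpaths G" using outside_qpaths[OF x, of "(fst z, snd z @ [a])"] by blast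
  then show "z \<in> qpaths G"
    by (cases z) (auto simp: qpaths_def)
next
  have "{z. ?y z \<noteq> \<zero>} \<subseteq> (\<lambda>z. (fst z, butlast (snd z))) ` {z. x z \<noteq> \<zero>}"
  proof
    fix z assume "z \<in> {z. ?y z \<noteq> \<zero>}"
    then have "x (fst z, snd z @ [a]) \<noteq> \<zero>" by (auto split: if_splits)
    then show "z \<in> (\<lambda>z. (fst z, butlast (snd z))) ` {z. x z \<noteq> \<zero>}"
      by (intro image_eqI[of _ _ "(fst z, snd z @ [a])"]) (auto simp: prod_eq_iff)
  qed
  moreover have "finite {z. x z \<noteq> \<zero>}" using x unfolding carrier_A by blast
  ultimately show "finite {z. ?y z \<noteq> \<zero>}" by (meson finite_imageI finite_subset)
qed

end

section \<open>The algebra \<open>\<Gamma>\<close>\<close>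

lemma quiver_Q_simps [simp]:
  "verts quiver_Q = {1, 2}" "a \<in> arcs quiver_Q"
  "tail quiver_Q Alpha = 1" "head quiver_Q Alpha = 1"
  "tail quiver_Q Beta = 1" "head quiver_Q Beta = 2"
  "tail quiver_Q Gamma = 2" "head quiver_Q Gamma = 2"
  by (cases a; simp add: quiver_Q_def)+

lemma wf_quiver_Q: "wf_digraph quiver_Q"
proof
  fix a show "tail quiver_Q a \<in> verts quiver_Q" "head quiver_Q a \<in> verts quiver_Q"
    by (cases a; simp)+
qed

locale quiver_Q_algebra = cring K for K :: "('k, 'r) ring_scheme" (structure)
begin

sublocale quiver_algebra K quiver_Q
  by (simp add: quiver_algebra_def is_cring wf_quiver_Q)

sublocale PA: ring A
  by (rule ring_A) simp

abbreviation \<alpha> where "\<alpha> \<equiv> arrow_elt K quiver_Q Alpha"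
abbreviation \<beta> where "\<beta> \<equiv> arrow_elt K quiver_Q Beta"
abbreviation \<gamma> where "\<gamma> \<equiv> arrow_elt K quiver_Q Gamma"
abbreviation e\<^sub>2 where "e\<^sub>2 \<equiv> path_elt K (2, [])"
abbreviation I where "I \<equiv> ideal_I K"

lemma elt_closed [simp]: "\<alpha> \<in> carrier A" "\<beta> \<in> carrier A" "\<gamma> \<in> carrier A" "e\<^sub>2 \<in> carrier A"
proof -
  show "\<alpha> \<in> carrier A" "\<beta> \<in> carrier A" "\<gamma> \<in> carrier A"
    unfolding arrow_elt_def by (rule path_elt_closed, rule qpathsI, rule arc_implies_awalk, simp)+
  show "e\<^sub>2 \<in> carrier A"
    by (rule path_elt_closed, rule qpathsI[of _ _ 2]) (simp add: awalk_Nil_iff)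
qed

lemma awalk_from_2: "awalk 2 p w \<Longrightarrow> w = 2 \<and> set p \<subseteq> {Gamma}"
proof (induction p)
  case (Cons a p)
  then have "tail quiver_Q a = 2" by (simp add: awalk_Cons_iff)
  then have "a = Gamma" by (cases a) auto
  then show ?case using Cons by (simp add: awalk_Cons_iff)
qed (simp add: awalk_Nil_iff)

lemma awalk_to_1: "awalk v p 1 \<Longrightarrow> v = 1 \<and> set p \<subseteq> {Alpha}"
proof (induction p arbitrary: v)
  case (Cons a p)
  then have "head quiver_Q a = 1" "v = tail quiver_Q a" "set p \<subseteq> {Alpha}"
    by (auto simp: awalk_Cons_iff)
  then show ?case by (cases a) auto
qed (simp add: awalk_Nil_iff)

lemma qpath_from_2:
  assumes "z \<in> qpaths quiver_Q" "fst z = 2"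
  shows "qtarget quiver_Q z = 2" "set (snd z) \<subseteq> {Gamma}"
  using awalk_from_2 qpathsD[OF assms(1)] assms(2) by auto

lemma qpath_to_1:
  assumes "z \<in> qpaths quiver_Q" "qtarget quiver_Q z = 1"
  shows "fst z = 1" "set (snd z) \<subseteq> {Alpha}"
  using awalk_to_1 qpathsD[OF assms(1)] assms(2) by auto

lemma mult_e2_right: "x \<in> carrier A \<Longrightarrow> (x \<otimes>\<^bsub>A\<^esub> e\<^sub>2) z = (if fst z = 2 then x z else \<zero>)"
  by (rule mult_vertex_right) auto

lemma mult_e2_left: "x \<in> carrier A \<Longrightarrow> (e\<^sub>2 \<otimes>\<^bsub>A\<^esub> x) z = (if qtarget quiver_Q z = 2 then x z else \<zero>)"
  by (rule mult_vertex_left) auto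

text \<open>
  No path leads from the vertex \<open>2\<close> to the vertex \<open>1\<close>.
\<close>

lemma e2_corner:
  assumes x: "x \<in> carrier A"
  shows "x \<otimes>\<^bsub>A\<^esub> e\<^sub>2 = e\<^sub>2 \<otimes>\<^bsub>A\<^esub> (x \<otimes>\<^bsub>A\<^esub> e\<^sub>2)"
proof
  fix z
  have "x z = \<zero>" if "fst z = 2" "qtarget quiver_Q z \<noteq> 2"
    using outside_qpaths[OF x, of z] qpath_from_2(1)[of z] that by auto
  then show "(x \<otimes>\<^bsub>A\<^esub> e\<^sub>2) z = (e\<^sub>2 \<otimes>\<^bsub>A\<^esub> (x \<otimes>\<^bsub>A\<^esub> e\<^sub>2)) z"
    using x by (simp add: mult_e2_left mult_e2_right)
qed

lemma e2_e2: "e\<^sub>2 \<otimes>\<^bsub>A\<^esub> e\<^sub>2 = e\<^sub>2"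
  by (rule ext, subst mult_e2_right, simp) (auto simp: path_elt_def)

lemma \<alpha>_e2: "\<alpha> \<otimes>\<^bsub>A\<^esub> e\<^sub>2 = \<zero>\<^bsub>A\<^esub>"
  by (rule ext, subst mult_e2_right, simp) (auto simp: path_elt_def arrow_elt_def)

lemma \<gamma>_e2: "\<gamma> \<otimes>\<^bsub>A\<^esub> e\<^sub>2 = \<gamma>"
  by (rule ext, subst mult_e2_right, simp) (auto simp: path_elt_def arrow_elt_def)

text \<open>
  All nontrivial paths that start at \<open>2\<close> begin with \<open>\<gamma>\<close>, so \<open>x e\<^sub>2\<close> is a left multiple of \<open>\<gamma>\<close> as soon
  as its coefficient at the trivial path vanishes.
\<close>

lemma \<gamma>_right_cancel:
  assumes x: "x \<in> carrier A" and x0: "(x \<otimes>\<^bsub>A\<^esub> \<gamma>) (2, [Gamma]) = \<zero>"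
  shows "\<exists>y \<in> carrier A. x \<otimes>\<^bsub>A\<^esub> e\<^sub>2 = y \<otimes>\<^bsub>A\<^esub> \<gamma>"
proof
  let ?y = "\<lambda>z. if fst z = head quiver_Q Gamma then x (tail quiver_Q Gamma, Gamma # snd z) else \<zero>"
  show y: "?y \<in> carrier A" by (rule strip_first_closed[OF x]) simp
  have x0': "x (2, []) = \<zero>" using x0 mult_arrow_right(1)[OF x, of Gamma 2 Gamma "[]"] by simp
  show "x \<otimes>\<^bsub>A\<^esub> e\<^sub>2 = ?y \<otimes>\<^bsub>A\<^esub> \<gamma>"
  proof
    fix z :: "nat \<times> arrow list"
    obtain v p where z: "z = (v, p)" by fastforce
    show "(x \<otimes>\<^bsub>A\<^esub> e\<^sub>2) z = (?y \<otimes>\<^bsub>A\<^esub> \<gamma>) z"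
    proof (cases p)
      case Nil
      then show ?thesis using x0' mult_arrow_right(2)[OF y, of Gamma v] by (simp add: z mult_e2_right[OF x])
    next
      case (Cons a q)
      have "x (2, a # q) = \<zero>" if "a \<noteq> Gamma"
        using outside_qpaths[OF x, of "(2, a # q)"] qpath_from_2(2)[of "(2, a # q)"] that by auto
      then show ?thesis
        using mult_arrow_right(1)[OF y, of Gamma v a q] by (auto simp: z Cons mult_e2_right[OF x])
    qed
  qed
qed

text \<open>
  An element supported on paths ending at \<open>1\<close> is a polynomial in \<open>\<alpha>\<close>.
\<close>

lemma mult_\<alpha>_commute:
  assumes B: "B \<in> carrier A" and supp: "\<And>z. B z \<noteq> \<zero> \<Longrightarrow> qtarget quiver_Q z = 1"
  shows "\<alpha> \<otimes>\<^bsub>A\<^esub> B = B \<otimes>\<^bsub>A\<^esub> \<alpha>"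
proof
  fix z :: "nat \<times> arrow list"
  obtain v p where z: "z = (v, p)" by fastforce
  have B0: "v = 1 \<and> (\<exists>n. q = replicate n Alpha)" if "B (v, q) \<noteq> \<zero>" for v q
  proof -
    have "(v, q) \<in> qpaths quiver_Q" using that outside_qpaths[OF B] by blast
    from qpath_to_1[OF this supp[OF that]] show ?thesis
      by (metis fst_conv insertE empty_iff replicate_length_same snd_conv subsetD)
  qed
  have t: "qtarget quiver_Q (1, replicate n Alpha) = 1" for n
    by (cases n) (simp_all add: replicate_append_same[symmetric] del: replicate_Suc add: replicate_Suc[of _ Alpha, folded replicate_append_same])
  consider n where "v = 1" "p = replicate n Alpha" | "\<nexists>n. v = 1 \<and> p = replicate n Alpha" by blast
  then show "(\<alpha> \<otimes>\<^bsub>A\<^esub> B) z = (B \<otimes>\<^bsub>A\<^esub> \<alpha>) z"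
  proof cases
    case 1
    show ?thesis
    proof (cases n)
      case 0
      then show ?thesis
        using mult_arrow_left(2)[OF B, of Alpha v] mult_arrow_right(2)[OF B, of Alpha v] 1 by (simp add: z)
    next
      case (Suc m)
      have "p = replicate m Alpha @ [Alpha]" "p = Alpha # replicate m Alpha"
        using 1 Suc by (simp_all add: replicate_append_same)
      then have "(\<alpha> \<otimes>\<^bsub>A\<^esub> B) z = B (1, replicate m Alpha)" "(B \<otimes>\<^bsub>A\<^esub> \<alpha>) z = B (1, replicate m Alpha)"
        using mult_arrow_left(1)[OF B, of Alpha v "replicate m Alpha" Alpha]
          mult_arrow_right(1)[OF B, of Alpha v Alpha "replicate m Alpha"] t[of m] 1 by (simp_all add: z)
      then show ?thesis by simp
    qed
  next
    case 2
    have "(\<alpha> \<otimes>\<^bsub>A\<^esub> B) z = \<zero>"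
    proof (cases p rule: rev_cases)
      case Nil
      then show ?thesis using mult_arrow_left(2)[OF B, of Alpha v] by (simp add: z)
    next
      case (snoc q a)
      have "B (v, q) = \<zero>" if "a = Alpha"
      proof (rule ccontr)
        assume "B (v, q) \<noteq> \<zero>"
        then obtain n where "v = 1" "q = replicate n Alpha" using B0 by blast
        then have "p = replicate (Suc n) Alpha" using snoc that by (simp add: replicate_append_same)
        then show False using 2 \<open>v = 1\<close> by blast
      qed
      then show ?thesis using mult_arrow_left(1)[OF B, of Alpha v q a] by (simp add: z snoc)
    qed
    moreover have "(B \<otimes>\<^bsub>A\<^esub> \<alpha>) z = \<zero>"
    proof (cases p)
      case Nil
      then show ?thesis using mult_arrow_right(2)[OF B, of Alpha v] by (simp add: z)
    next
      case (Cons a q)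
      have "B (1, q) = \<zero>" if "a = Alpha" "v = 1"
      proof (rule ccontr)
        assume "B (1, q) \<noteq> \<zero>"
        then obtain n where "q = replicate n Alpha" using B0 by blast
        then have "p = replicate (Suc n) Alpha" using Cons that by simp
        then show False using 2 \<open>v = 1\<close> by blast
      qed
      then show ?thesis using mult_arrow_right(1)[OF B, of Alpha v a q] by (auto simp: z Cons)
    qed
    ultimately show ?thesis by simp
  qed
qed

text \<open>
  Sort the paths that end at \<open>2\<close> by their last arrow: \<open>E\<close> is the multiple of the trivial path, \<open>B\<close>
  and \<open>D\<close> collect what precedes a last \<open>\<beta>\<close> and a last \<open>\<gamma>\<close>.
\<close>

lemma e2_decomposition:
  assumes x: "x \<in> carrier A"
  obtains E B D where "E \<in> carrier A" "B \<in> carrier A" "D \<in> carrier A"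
    "e\<^sub>2 \<otimes>\<^bsub>A\<^esub> x = E \<oplus>\<^bsub>A\<^esub> (\<beta> \<otimes>\<^bsub>A\<^esub> B \<oplus>\<^bsub>A\<^esub> \<gamma> \<otimes>\<^bsub>A\<^esub> D)"
    "E \<otimes>\<^bsub>A\<^esub> e\<^sub>2 = E" "E \<otimes>\<^bsub>A\<^esub> \<alpha> = \<zero>\<^bsub>A\<^esub>" "B \<otimes>\<^bsub>A\<^esub> e\<^sub>2 = \<zero>\<^bsub>A\<^esub>" "\<alpha> \<otimes>\<^bsub>A\<^esub> B = B \<otimes>\<^bsub>A\<^esub> \<alpha>"
proof -
  define E where "E z = (if z = (2, []) then x z else \<zero>)" for z
  define B where "B z = (if qtarget quiver_Q z = tail quiver_Q Beta then x (fst z, snd z @ [Beta]) else \<zero>)" for z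
  define D where "D z = (if qtarget quiver_Q z = tail quiver_Q Gamma then x (fst z, snd z @ [Gamma]) else \<zero>)" for z
  have E: "E \<in> carrier A"
    by (rule carrier_A_subset[OF x]) (use x in \<open>auto simp: E_def split: if_splits\<close>)
  have B: "B \<in> carrier A" unfolding B_def by (rule strip_last_closed[OF x]) simp
  have D: "D \<in> carrier A" unfolding D_def by (rule strip_last_closed[OF x]) simp
  have B1: "qtarget quiver_Q z = 1" if "B z \<noteq> \<zero>" for z
    using that by (auto simp: B_def split: if_splits)
  have "B z = \<zero>" if "fst z = 2" for z
    using outside_qpaths[OF B, of z] B1[of z] qpath_to_1(1)[of z] that by auto
  then have "B \<otimes>\<^bsub>A\<^esub> e\<^sub>2 = \<zero>\<^bsub>A\<^esub>" by (intro ext) (simp add: mult_e2_right[OF B])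
  moreover have "E \<otimes>\<^bsub>A\<^esub> e\<^sub>2 = E" by (rule ext) (auto simp: mult_e2_right[OF E] E_def)
  moreover have "E \<otimes>\<^bsub>A\<^esub> \<alpha> = \<zero>\<^bsub>A\<^esub>"
  proof
    fix z :: "nat \<times> arrow list"
    obtain v p where z: "z = (v, p)" by fastforce
    show "(E \<otimes>\<^bsub>A\<^esub> \<alpha>) z = \<zero>\<^bsub>A\<^esub> z"
      using mult_arrow_right[OF E, of Alpha v] by (cases p) (auto simp: z E_def)
  qed
  moreover have "e\<^sub>2 \<otimes>\<^bsub>A\<^esub> x = E \<oplus>\<^bsub>A\<^esub> (\<beta> \<otimes>\<^bsub>A\<^esub> B \<oplus>\<^bsub>A\<^esub> \<gamma> \<otimes>\<^bsub>A\<^esub> D)"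
  proof
    fix z :: "nat \<times> arrow list"
    obtain v p where z: "z = (v, p)" by fastforce
    show "(e\<^sub>2 \<otimes>\<^bsub>A\<^esub> x) z = (E \<oplus>\<^bsub>A\<^esub> (\<beta> \<otimes>\<^bsub>A\<^esub> B \<oplus>\<^bsub>A\<^esub> \<gamma> \<otimes>\<^bsub>A\<^esub> D)) z"
    proof (cases p rule: rev_cases)
      case Nil
      then show ?thesis
        using mult_arrow_left(2)[OF B, of Beta v] mult_arrow_left(2)[OF D, of Gamma v] x
        by (auto simp: z mult_e2_left[OF x] E_def)
    next
      case (snoc q a)
      have no_path: "x (v, q @ [a]) = \<zero>" if "qtarget quiver_Q (v, q) \<noteq> tail quiver_Q a"
        using outside_qpaths[OF x, of "(v, q @ [a])"] that by (auto simp: qpaths_def awalk_Cons_iff qtarget_def)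
      then show ?thesis
        using mult_arrow_left(1)[OF B, of Beta v q a] mult_arrow_left(1)[OF D, of Gamma v q a] x
        by (cases a) (auto simp: z snoc mult_e2_left[OF x] E_def B_def D_def)
    qed
  qed
  ultimately show ?thesis using that E B D mult_\<alpha>_commute[OF B B1] by blast
qed

abbreviation gens where
  "gens \<equiv> {(\<beta> \<otimes>\<^bsub>A\<^esub> \<alpha>) \<ominus>\<^bsub>A\<^esub> (\<gamma> \<otimes>\<^bsub>A\<^esub> \<beta>), \<alpha> \<otimes>\<^bsub>A\<^esub> \<alpha>, \<gamma> \<otimes>\<^bsub>A\<^esub> \<gamma>}"

lemma I_eq: "I = Idl\<^bsub>A\<^esub> gens"
  by (simp add: ideal_I_def Let_def)

lemma gens_closed: "gens \<subseteq> carrier A" by simp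

lemma ideal_I: "ideal I A"
  unfolding I_eq by (rule PA.genideal_ideal[OF gens_closed])

lemma gens_in_I: "gens \<subseteq> I"
  unfolding I_eq by (rule PA.genideal_self[OF gens_closed])

lemma mult_arrow_short_path:
  assumes x: "x \<in> carrier A" "x (w, []) = \<zero>" "x (head quiver_Q a, []) = \<zero>" and z: "length (snd z) \<le> 1"
  shows "(x \<otimes>\<^bsub>A\<^esub> arrow_elt K quiver_Q a) z = \<zero>"
proof -
  obtain v p where z': "z = (v, p)" by fastforce
  show ?thesis
    using mult_arrow_right[OF x(1), of a v] x z by (cases p) (auto simp: z')
qed

text \<open>
  The relations are combinations of paths of length two, so coefficients at shorter paths are well
  defined on \<open>\<Gamma>\<close>.
\<close>

lemma I_long: "I \<subseteq> long_ideal 1"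
  unfolding I_eq
proof (rule PA.genideal_minimal)
  show "ideal (long_ideal 1) A" by (rule ideal_long_ideal) simp
  have *: "(arrow_elt K quiver_Q a \<otimes>\<^bsub>A\<^esub> arrow_elt K quiver_Q b) \<in> long_ideal 1" for a b
  proof -
    have a: "arrow_elt K quiver_Q a \<in> carrier A" and b: "arrow_elt K quiver_Q b \<in> carrier A"
      by (cases a; simp) (cases b; simp)
    have "(arrow_elt K quiver_Q a \<otimes>\<^bsub>A\<^esub> arrow_elt K quiver_Q b) z = \<zero>" if "length (snd z) \<le> 1" for z
      by (rule mult_arrow_short_path[OF a _ _ that]) (simp_all add: arrow_elt_def path_elt_def)
    then show ?thesis using PA.m_closed[OF a b] by (simp add: long_ideal_def)
  qed
  interpret L: ideal "long_ideal 1" A by (rule ideal_long_ideal) simp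
  have "\<beta> \<otimes>\<^bsub>A\<^esub> \<alpha> \<ominus>\<^bsub>A\<^esub> \<gamma> \<otimes>\<^bsub>A\<^esub> \<beta> \<in> long_ideal 1"
    unfolding a_minus_def by (rule L.a_closed[OF * L.a_inv_closed[OF *]])
  then show "gens \<subseteq> long_ideal 1" using * by blast
qed

text \<open>
  In \<open>\<Gamma>\<close>, the right ideal generated by \<open>\<gamma>\<close> lies in the left ideal generated by \<open>u = \<alpha> + e\<^sub>2\<close>: in the decomposition of
  \<open>e\<^sub>2 x\<close> the factor \<open>\<gamma>\<close> kills \<open>\<gamma> D\<close>, turns \<open>\<beta> B\<close> into \<open>\<beta> \<alpha> B = \<beta> B \<alpha>\<close>, and
  \<open>\<gamma> E\<close> is fixed by \<open>e\<^sub>2\<close>.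
\<close>

lemma \<gamma>_left:
  assumes x: "x \<in> carrier A"
  shows "\<exists>y \<in> carrier A. \<gamma> \<otimes>\<^bsub>A\<^esub> x \<ominus>\<^bsub>A\<^esub> y \<otimes>\<^bsub>A\<^esub> (\<alpha> \<oplus>\<^bsub>A\<^esub> e\<^sub>2) \<in> I"
proof -
  interpret I: ideal I A by (rule ideal_I)
  obtain E B D where c: "E \<in> carrier A" "B \<in> carrier A" "D \<in> carrier A"
    and dec: "e\<^sub>2 \<otimes>\<^bsub>A\<^esub> x = E \<oplus>\<^bsub>A\<^esub> (\<beta> \<otimes>\<^bsub>A\<^esub> B \<oplus>\<^bsub>A\<^esub> \<gamma> \<otimes>\<^bsub>A\<^esub> D)"
    and E: "E \<otimes>\<^bsub>A\<^esub> e\<^sub>2 = E" "E \<otimes>\<^bsub>A\<^esub> \<alpha> = \<zero>\<^bsub>A\<^esub>"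
    and B: "B \<otimes>\<^bsub>A\<^esub> e\<^sub>2 = \<zero>\<^bsub>A\<^esub>" "\<alpha> \<otimes>\<^bsub>A\<^esub> B = B \<otimes>\<^bsub>A\<^esub> \<alpha>"
    by (rule e2_decomposition[OF x])
  let ?y = "\<gamma> \<otimes>\<^bsub>A\<^esub> E \<oplus>\<^bsub>A\<^esub> \<beta> \<otimes>\<^bsub>A\<^esub> B"
  have "\<gamma> \<otimes>\<^bsub>A\<^esub> x = \<gamma> \<otimes>\<^bsub>A\<^esub> (e\<^sub>2 \<otimes>\<^bsub>A\<^esub> x)"
    using x \<gamma>_e2 PA.m_assoc[of \<gamma> "e\<^sub>2" x] by simp
  also have "\<dots> = \<gamma> \<otimes>\<^bsub>A\<^esub> E \<oplus>\<^bsub>A\<^esub> ((\<gamma> \<otimes>\<^bsub>A\<^esub> \<beta>) \<otimes>\<^bsub>A\<^esub> B \<oplus>\<^bsub>A\<^esub> (\<gamma> \<otimes>\<^bsub>A\<^esub> \<gamma>) \<otimes>\<^bsub>A\<^esub> D)"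
    unfolding dec using c by (simp add: PA.r_distr PA.m_assoc)
  finally have gx: "\<gamma> \<otimes>\<^bsub>A\<^esub> x = \<dots>" .
  have "?y \<otimes>\<^bsub>A\<^esub> (\<alpha> \<oplus>\<^bsub>A\<^esub> e\<^sub>2) = \<gamma> \<otimes>\<^bsub>A\<^esub> E \<oplus>\<^bsub>A\<^esub> (\<beta> \<otimes>\<^bsub>A\<^esub> \<alpha>) \<otimes>\<^bsub>A\<^esub> B"
    using c by (simp add: PA.r_distr PA.l_distr PA.m_assoc PA.a_comm E B)
  then have "\<gamma> \<otimes>\<^bsub>A\<^esub> x \<ominus>\<^bsub>A\<^esub> ?y \<otimes>\<^bsub>A\<^esub> (\<alpha> \<oplus>\<^bsub>A\<^esub> e\<^sub>2) =
      (\<gamma> \<otimes>\<^bsub>A\<^esub> \<gamma>) \<otimes>\<^bsub>A\<^esub> D \<ominus>\<^bsub>A\<^esub> (\<beta> \<otimes>\<^bsub>A\<^esub> \<alpha> \<ominus>\<^bsub>A\<^esub> \<gamma> \<otimes>\<^bsub>A\<^esub> \<beta>) \<otimes>\<^bsub>A\<^esub> B"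
    unfolding gx using c elt_closed by algebra
  also have "\<dots> \<in> I"
    using gens_in_I c by (simp add: I.a_closed I.a_inv_closed I.I_r_closed a_minus_def)
  finally show ?thesis using c by (intro bexI[of _ ?y]) simp_all
qed

text \<open>
  The quotient scalar multiplication is a union over representatives; all of them give the same coset
  because scaling by \<open>c\<close> is multiplication by \<open>c \<cdot> 1\<close>, which preserves \<open>I\<close>.
\<close>

lemma smult_coset:
  assumes c: "c \<in> carrier K" and x: "x \<in> carrier A"
  shows "c \<odot>\<^bsub>algebra_Gamma K\<^esub> (I +>\<^bsub>A\<^esub> x) = I +>\<^bsub>A\<^esub> (c \<odot>\<^bsub>A\<^esub> x)"
proof -
  interpret I: ideal I A by (rule ideal_I)
  have "I +>\<^bsub>A\<^esub> (c \<odot>\<^bsub>A\<^esub> y) = I +>\<^bsub>A\<^esub> (c \<odot>\<^bsub>A\<^esub> x)" if y: "y \<in> I +>\<^bsub>A\<^esub> x" for y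
  proof -
    have yc: "y \<in> carrier A" using y PA.a_r_coset_subset_G[OF I.a_subset x] by blast
    have c1: "c \<odot>\<^bsub>A\<^esub> \<one>\<^bsub>A\<^esub> \<in> carrier A" using smult_A_closed[OF c] by simp
    have mult: "c \<odot>\<^bsub>A\<^esub> f = (c \<odot>\<^bsub>A\<^esub> \<one>\<^bsub>A\<^esub>) \<otimes>\<^bsub>A\<^esub> f" if "f \<in> carrier A" for f
      using smult_mult_A[OF c _ that, of "\<one>\<^bsub>A\<^esub>"] that by simp
    have "I +>\<^bsub>A\<^esub> y = I +>\<^bsub>A\<^esub> x" using PA.a_repr_independence[OF y x I.a_subgroup] by simp
    then have "y \<ominus>\<^bsub>A\<^esub> x \<in> I" using PA.quotient_eq_iff_same_a_r_cos[OF ideal_I yc x] by simp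
    then have "(c \<odot>\<^bsub>A\<^esub> \<one>\<^bsub>A\<^esub>) \<otimes>\<^bsub>A\<^esub> (y \<ominus>\<^bsub>A\<^esub> x) \<in> I"
      by (rule I.I_l_closed) (rule c1)
    moreover have "(c \<odot>\<^bsub>A\<^esub> \<one>\<^bsub>A\<^esub>) \<otimes>\<^bsub>A\<^esub> (y \<ominus>\<^bsub>A\<^esub> x) =
        (c \<odot>\<^bsub>A\<^esub> \<one>\<^bsub>A\<^esub>) \<otimes>\<^bsub>A\<^esub> y \<ominus>\<^bsub>A\<^esub> (c \<odot>\<^bsub>A\<^esub> \<one>\<^bsub>A\<^esub>) \<otimes>\<^bsub>A\<^esub> x"
      unfolding a_minus_def using c1 yc x by (simp add: PA.r_distr PA.r_minus)
    ultimately show ?thesis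
      using PA.quotient_eq_iff_same_a_r_cos[OF ideal_I PA.m_closed[OF c1 yc] PA.m_closed[OF c1 x]]
        mult[OF yc] mult[OF x] by metis
  qed
  then show ?thesis
    using UN_constant_eq[OF I.a_rcos_self[OF x], of "\<lambda>y. I +>\<^bsub>A\<^esub> (c \<odot>\<^bsub>A\<^esub> y)"]
    by (simp add: algebra_Gamma_def quotient_algebra_def)
qed

text \<open>
  Transport of the elements \<open>e\<^sub>2\<close>, \<open>\<alpha> + e\<^sub>2\<close>, \<open>\<gamma>\<close> and of the coefficient of \<open>\<beta>\<close> along a
  surjection \<open>\<pi>\<close> from the path algebra to \<open>End T\<close> with kernel \<open>I\<close>.
\<close>

lemma no_tilting_presentation:
  assumes CY: "two_CY_category K C" and tilt: "cluster_tilting C T"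
    and h: "h \<in> algebra_iso K (algebra_Gamma K) (End_algebra C T)"
    and nontriv: "\<one> \<noteq> \<zero>"
  shows False
proof -
  interpret I: ideal I A by (rule ideal_I)
  interpret C: two_CY_category K C by (rule CY)
  define \<pi> where "\<pi> x = h (I +>\<^bsub>A\<^esub> x)" for x
  let ?E = "Hom C T T"
  have h_hom: "h \<in> ring_hom (algebra_Gamma K) (End_algebra C T)"
    and h_bij: "bij_betw h (carrier (algebra_Gamma K)) (mor C T T)"
    and h_smult: "\<And>c U. \<lbrakk>c \<in> carrier K; U \<in> carrier (algebra_Gamma K)\<rbrakk>
        \<Longrightarrow> h (c \<odot>\<^bsub>algebra_Gamma K\<^esub> U) = c \<odot>\<^bsub>?E\<^esub> h U"
    using h by (auto simp: algebra_iso_def ring_iso_def End_algebra_def)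
  have q: "ring_hom_ring A (A Quot I) ((+>\<^bsub>A\<^esub>) I)" by (rule I.rcos_ring_hom_ring)
  have carr: "carrier (algebra_Gamma K) = carrier (A Quot I)"
    and ops: "\<And>x y. x \<otimes>\<^bsub>algebra_Gamma K\<^esub> y = x \<otimes>\<^bsub>A Quot I\<^esub> y"
      "\<And>x y. x \<oplus>\<^bsub>algebra_Gamma K\<^esub> y = x \<oplus>\<^bsub>A Quot I\<^esub> y"
    by (simp_all add: algebra_Gamma_def quotient_algebra_def)
  have coset: "I +>\<^bsub>A\<^esub> x \<in> carrier (algebra_Gamma K)" if "x \<in> carrier A" for x
    using ring_hom_closed[OF I.rcos_ring_hom that] carr by simp
  have \<pi>_closed: "\<pi> x \<in> mor C T T" if "x \<in> carrier A" for x
    using h_bij coset[OF that] by (auto simp: \<pi>_def bij_betw_def)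
  have \<pi>_mult: "\<pi> (x \<otimes>\<^bsub>A\<^esub> y) = \<pi> x \<star>\<^bsub>C\<^esub> \<pi> y" if "x \<in> carrier A" "y \<in> carrier A" for x y
    using ring_hom_mult[OF h_hom coset[OF that(1)] coset[OF that(2)]]
      ring_hom_mult[OF I.rcos_ring_hom that] by (simp add: \<pi>_def ops End_algebra_def)
  have \<pi>_add: "\<pi> (x \<oplus>\<^bsub>A\<^esub> y) = \<pi> x \<oplus>\<^bsub>?E\<^esub> \<pi> y" if "x \<in> carrier A" "y \<in> carrier A" for x y
    using ring_hom_add[OF h_hom coset[OF that(1)] coset[OF that(2)]]
      ring_hom_add[OF I.rcos_ring_hom that] by (simp add: \<pi>_def ops End_algebra_def)
  have \<pi>_smult: "\<pi> (c \<odot>\<^bsub>A\<^esub> x) = c \<odot>\<^bsub>?E\<^esub> \<pi> x" if "c \<in> carrier K" "x \<in> carrier A" for c x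
    using h_smult[OF that(1) coset[OF that(2)]] smult_coset[OF that] by (simp add: \<pi>_def)
  have \<pi>_surj: "\<exists>x \<in> carrier A. m = \<pi> x" if m: "m \<in> mor C T T" for m
  proof -
    obtain U where U: "U \<in> carrier (algebra_Gamma K)" "m = h U"
      using h_bij m by (auto simp: bij_betw_def)
    then obtain x where "x \<in> carrier A" "U = I +>\<^bsub>A\<^esub> x"
      using carr by (auto simp: FactRing_simps)
    then show ?thesis using U by (auto simp: \<pi>_def)
  qed
  have \<pi>_eq: "\<pi> x = \<pi> y \<longleftrightarrow> x \<ominus>\<^bsub>A\<^esub> y \<in> I" if "x \<in> carrier A" "y \<in> carrier A" for x y
    using PA.quotient_eq_iff_same_a_r_cos[OF ideal_I that] coset[OF that(1)] coset[OF that(2)] h_bij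
    by (auto simp: \<pi>_def bij_betw_def inj_on_def)
  have T: "T \<in> Ob C" using tilt by (simp add: cluster_tilting_def)
  interpret E: abelian_group ?E by (rule C.Hom_group[OF T T])
  have \<pi>_0: "\<pi> \<zero>\<^bsub>A\<^esub> = \<zero>\<^bsub>?E\<^esub>"
    using \<pi>_add[of "\<zero>\<^bsub>A\<^esub>" "\<zero>\<^bsub>A\<^esub>"] \<pi>_closed[of "\<zero>\<^bsub>A\<^esub>"] E.add.l_cancel_one'[of "\<pi> \<zero>\<^bsub>A\<^esub>" "\<pi> \<zero>\<^bsub>A\<^esub>"] by simp
  have \<pi>_0_iff: "\<pi> x = \<zero>\<^bsub>?E\<^esub> \<longleftrightarrow> x \<in> I" if "x \<in> carrier A" for x
    using \<pi>_eq[OF that PA.zero_closed] that by (simp add: \<pi>_0 a_minus_def)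
  have coeff: "x z = y z" if "x \<in> carrier A" "y \<in> carrier A" "\<pi> x = \<pi> y" "length (snd z) \<le> 1" for x y z
  proof -
    have "x \<ominus>\<^bsub>A\<^esub> y \<in> long_ideal 1" using \<pi>_eq[OF that(1,2)] that(3) I_long by blast
    then have "(x \<ominus>\<^bsub>A\<^esub> y) z = \<zero>" using that(4) by (simp add: long_ideal_def)
    then show ?thesis using that(1,2) by (simp add: a_minus_def neg_A[OF that(2)] r_right_minus_eq[unfolded a_minus_def])
  qed

  define \<phi> where "\<phi> = (\<lambda>m \<in> mor C T T. (SOME x. x \<in> carrier A \<and> \<pi> x = m) (1, [Beta]))"
  have \<phi>: "\<phi> (\<pi> x) = x (1, [Beta])" if x: "x \<in> carrier A" for x
  proof -
    have "(SOME y. y \<in> carrier A \<and> \<pi> y = \<pi> x) \<in> carrier A \<and> \<pi> (SOME y. y \<in> carrier A \<and> \<pi> y = \<pi> x) = \<pi> x"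
      by (rule someI[of _ x]) (use x in simp)
    then show ?thesis using coeff[OF _ x, of _ "(1, [Beta])"] \<pi>_closed[OF x] by (simp add: \<phi>_def)
  qed
  let ?u = "\<alpha> \<oplus>\<^bsub>A\<^esub> e\<^sub>2"
  have "tilting_obstruction K C T (\<pi> e\<^sub>2) (\<pi> ?u) (\<pi> \<gamma>) \<phi>"
  proof (intro tilting_obstruction.intro tilting_obstruction_axioms.intro)
    show "two_CY_category K C" "cluster_tilting C T" by fact+
    show "\<pi> e\<^sub>2 \<in> mor C T T" "\<pi> ?u \<in> mor C T T" "\<pi> \<gamma> \<in> mor C T T"
      by (rule \<pi>_closed, simp)+
    show "\<pi> e\<^sub>2 \<star>\<^bsub>C\<^esub> \<pi> e\<^sub>2 = \<pi> e\<^sub>2" using \<pi>_mult[of "e\<^sub>2" "e\<^sub>2"] e2_e2 by simp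
    show "\<pi> ?u \<star>\<^bsub>C\<^esub> \<pi> e\<^sub>2 = \<pi> e\<^sub>2"
      using \<pi>_mult[of ?u "e\<^sub>2"] by (simp add: PA.l_distr \<alpha>_e2 e2_e2)
    show "\<pi> \<gamma> \<star>\<^bsub>C\<^esub> \<pi> e\<^sub>2 = \<pi> \<gamma>" using \<pi>_mult[of \<gamma> "e\<^sub>2"] \<gamma>_e2 by simp
    show "\<pi> \<gamma> \<star>\<^bsub>C\<^esub> \<pi> \<gamma> = \<zero>\<^bsub>?E\<^esub>"
      using \<pi>_mult[of \<gamma> \<gamma>] \<pi>_0_iff[of "\<gamma> \<otimes>\<^bsub>A\<^esub> \<gamma>"] gens_in_I by simp
  next
    fix m assume "m \<in> mor C T T"
    then obtain x where x: "x \<in> carrier A" "m = \<pi> x" using \<pi>_surj by blast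
    show "m \<star>\<^bsub>C\<^esub> \<pi> e\<^sub>2 = \<pi> e\<^sub>2 \<star>\<^bsub>C\<^esub> (m \<star>\<^bsub>C\<^esub> \<pi> e\<^sub>2)"
      using e2_corner[OF x(1)] x \<pi>_mult[of x "e\<^sub>2"] \<pi>_mult[of "e\<^sub>2" "x \<otimes>\<^bsub>A\<^esub> e\<^sub>2"] by simp
    show "\<exists>n \<in> mor C T T. m \<star>\<^bsub>C\<^esub> \<pi> e\<^sub>2 = n \<star>\<^bsub>C\<^esub> \<pi> \<gamma>" if "m \<star>\<^bsub>C\<^esub> \<pi> \<gamma> = \<zero>\<^bsub>?E\<^esub>"
    proof -
      have "x \<otimes>\<^bsub>A\<^esub> \<gamma> \<in> long_ideal 1"
        using that x \<pi>_mult[of x \<gamma>] \<pi>_0_iff[of "x \<otimes>\<^bsub>A\<^esub> \<gamma>"] I_long by auto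
      then have "(x \<otimes>\<^bsub>A\<^esub> \<gamma>) (2, [Gamma]) = \<zero>" by (simp add: long_ideal_def)
      then obtain y where y: "y \<in> carrier A" "x \<otimes>\<^bsub>A\<^esub> e\<^sub>2 = y \<otimes>\<^bsub>A\<^esub> \<gamma>"
        using \<gamma>_right_cancel[OF x(1)] by blast
      have "m \<star>\<^bsub>C\<^esub> \<pi> e\<^sub>2 = \<pi> y \<star>\<^bsub>C\<^esub> \<pi> \<gamma>"
        using \<pi>_mult[of x "e\<^sub>2"] \<pi>_mult[of y \<gamma>] x y by simp
      then show ?thesis using \<pi>_closed[OF y(1)] by blast
    qed
    show "\<exists>n \<in> mor C T T. \<pi> \<gamma> \<star>\<^bsub>C\<^esub> m = n \<star>\<^bsub>C\<^esub> \<pi> ?u"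
    proof -
      obtain y where y: "y \<in> carrier A" "\<gamma> \<otimes>\<^bsub>A\<^esub> x \<ominus>\<^bsub>A\<^esub> y \<otimes>\<^bsub>A\<^esub> ?u \<in> I"
        using \<gamma>_left[OF x(1)] by blast
      then have "\<pi> \<gamma> \<star>\<^bsub>C\<^esub> m = \<pi> y \<star>\<^bsub>C\<^esub> \<pi> ?u"
        using \<pi>_eq[of "\<gamma> \<otimes>\<^bsub>A\<^esub> x" "y \<otimes>\<^bsub>A\<^esub> ?u"] \<pi>_mult[of \<gamma> x] \<pi>_mult[of y ?u] x by simp
      then show ?thesis using \<pi>_closed[OF y(1)] by blast
    qed
    show "\<phi> (m \<star>\<^bsub>C\<^esub> \<pi> ?u) = \<zero>"
    proof -
      have "(x \<otimes>\<^bsub>A\<^esub> ?u) (1, [Beta]) = (x \<otimes>\<^bsub>A\<^esub> \<alpha>) (1, [Beta]) \<oplus> (x \<otimes>\<^bsub>A\<^esub> e\<^sub>2) (1, [Beta])"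
        using x by (simp add: PA.r_distr)
      also have "\<dots> = \<zero>"
        using mult_arrow_right(1)[OF x(1), of Alpha 1 Beta "[]"] mult_e2_right[OF x(1)] by simp
      finally show ?thesis using \<pi>_mult[of x ?u] \<phi>[of "x \<otimes>\<^bsub>A\<^esub> ?u"] x by simp
    qed
  next
    show "\<phi> \<in> carrier (dual_space K ?E)"
    proof -
      have "\<phi> m \<in> carrier K" if m: "m \<in> mor C T T" for m
        using \<pi>_surj[OF m] \<phi> by auto
      moreover have "\<phi> (m \<oplus>\<^bsub>?E\<^esub> n) = \<phi> m \<oplus> \<phi> n" if m: "m \<in> mor C T T" and n: "n \<in> mor C T T" for m n
      proof -
        obtain x y where "x \<in> carrier A" "m = \<pi> x" "y \<in> carrier A" "n = \<pi> y"
          using \<pi>_surj[OF m] \<pi>_surj[OF n] by blast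
        then show ?thesis using \<phi>[of "x \<oplus>\<^bsub>A\<^esub> y"] \<pi>_add[of x y] \<phi> by simp
      qed
      moreover have "\<phi> (c \<odot>\<^bsub>?E\<^esub> m) = c \<otimes> \<phi> m" if c: "c \<in> carrier K" and m: "m \<in> mor C T T" for c m
      proof -
        obtain x where "x \<in> carrier A" "m = \<pi> x" using \<pi>_surj[OF m] by blast
        then show ?thesis using \<phi>[of "c \<odot>\<^bsub>A\<^esub> x"] \<pi>_smult[OF c, of x] \<phi>[of x] smult_A_closed[OF c] by simp
      qed
      moreover have "\<phi> \<in> extensional (mor C T T)" by (simp add: \<phi>_def)
      ultimately show ?thesis by (simp add: dual_space_def module_hom_def self_module_def)
    qed
    show "\<exists>m \<in> mor C T T. \<phi> (\<pi> e\<^sub>2 \<star>\<^bsub>C\<^esub> m) \<noteq> \<zero>"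
    proof
      have "(e\<^sub>2 \<otimes>\<^bsub>A\<^esub> \<beta>) (1, [Beta]) = \<beta> (1, [Beta])"
        using qtarget_snoc[of 1 "[]" Beta] mult_e2_left[OF elt_closed(2)] by simp
      also have "\<dots> = \<one>" by (simp add: arrow_elt_def path_elt_def)
      finally show "\<phi> (\<pi> e\<^sub>2 \<star>\<^bsub>C\<^esub> \<pi> \<beta>) \<noteq> \<zero>"
        using \<phi>[of "e\<^sub>2 \<otimes>\<^bsub>A\<^esub> \<beta>"] \<pi>_mult[of "e\<^sub>2" \<beta>] nontriv by simp
    qed (rule \<pi>_closed, simp)
  qed
  then show False by (rule tilting_obstruction.inconsistent)
qed

end

theorem mainTheorem3:
  fixes K :: "('k, 'r) ring_scheme"
  assumes "algebraically_closed K" and "char_zero K"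
  shows "\<not> two_CY_tilted TYPE('o) TYPE('m) K (algebra_Gamma K)"
proof
  interpret field K using assms(1) by (rule algebraically_closed.axioms(1))
  interpret quiver_Q_algebra K by (simp add: quiver_Q_algebra_def is_cring)
  assume "two_CY_tilted TYPE('o) TYPE('m) K (algebra_Gamma K)"
  then obtain C :: "('k, 'o, 'm) tri_cat" and T h where
    "two_CY_category K C" "cluster_tilting C T" "h \<in> algebra_iso K (algebra_Gamma K) (End_algebra C T)"
    by (auto simp: two_CY_tilted_def)
  then show False by (rule no_tilting_presentation) simp
qed

end
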